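(* Let $X$ be a complete linear metric space and let $C\subset X$ be a closed convex subset. Then the following conditions are equivalent: (1) $C$ is polyhedral in its closed linear hull $\overline{\mathrm{lin}}(C)$; (2) $C$ is polyhedric in its affine hull $\mathrm{aff}(C)$; (3) $C$ hides no infinite subset $A\subset X\setminus C$.
   Context: All linear spaces are over $\mathbb{R}$. A linear metric space is a linear topological space whose topology is generated by a metric; it is complete if its topology is generated by a complete translation-invariant metric. For a subset $C$ of a linear topological space, $\overline{\mathrm{lin}}(C)$ denotes the closure of the linear span of $C$, and $\mathrm{aff}(C)$ denotes the affine hull of $C$ (not closed). Polyhedral: a convex subset $C$ of a linear topological space $L$ is polyhedral in $L$ if $C=\bigcap_{i=1}^n f_i^{-1}\big((-\infty,a_i]\big)$ for some finite collection of continuous linear functionals $f_1,\dots,f_n:L\to\mathbb{R}$ (the zero functional is allowed) and real numbers $a_1,\dots,a_n$. Polyhedric: a convex subset $C$ of a linear space $L$ is polyhedric in a convex set $D\subset L$ with $D\supset C$ if $C=\bigcap_{i=1}^n H_i$ for some finite collection of convex subsets $H_1,\dots,H_n\subset D$ whose complements $D\setminus H_i$, $i\le n$, are convex. Hides: a subset $C$ of a linear space $L$ hides a set $A\subset L$ (equivalently, $A$ is hidden behind $C$) if $A\subset L\setminus C$ and for any distinct points $a,b\in A$ the closed segment $[a,b]=\{ta+(1-t)b:t\in[0,1]\}$ meets $C$. *)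

theory Defs
  imports "HOL-Analysis.Analysis"
begin

class linear_topological_space = real_vector + topological_ab_group_add +
  assumes tendsto_scaleR_Pair:
    "LIM p (nhds t \<times>\<^sub>F nhds x). fst p *\<^sub>R snd p :> nhds (t *\<^sub>R x)"

instance real_normed_vector \<subseteq> linear_topological_space
proof
  fix t :: real and x :: 'a
  show "LIM p (nhds t \<times>\<^sub>F nhds x). fst p *\<^sub>R snd p :> nhds (t *\<^sub>R x)"
    unfolding nhds_prod[symmetric]
    by (intro tendsto_intros) (auto simp: nhds_prod intro: filterlim_fst filterlim_snd)
qed

definition complete_linear_metric_space :: "'a::linear_topological_space itself \<Rightarrow> bool"
  where "complete_linear_metric_space _ \<longleftrightarrow>
    (\<exists>d :: 'a \<Rightarrow> 'a \<Rightarrow> real.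
       Metric_space UNIV d \<and>
       Metric_space.mtopology UNIV d = euclidean \<and>
       Metric_space.mcomplete UNIV d \<and>
       (\<forall>x y z. d (x + z) (y + z) = d x y))"

text \<open>A functional on a linear subspace \<open>L\<close> is represented by a function on the whole type of
  which only the values on \<open>L\<close> matter. No continuous linear extension is required: without local
  convexity there may be none.\<close>

definition continuous_linear_functional_on ::
    "'a::linear_topological_space set \<Rightarrow> ('a \<Rightarrow> real) \<Rightarrow> bool"
  where "continuous_linear_functional_on L f \<longleftrightarrow>
    (\<forall>x\<in>L. \<forall>y\<in>L. f (x + y) = f x + f y) \<and>
    (\<forall>c. \<forall>x\<in>L. f (c *\<^sub>R x) = c * f x) \<and>
    continuous_on L f"

definition polyhedral_in :: "'a::linear_topological_space set \<Rightarrow> 'a set \<Rightarrow> bool"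
  where "polyhedral_in C L \<longleftrightarrow>
    convex C \<and> C \<subseteq> L \<and>
    (\<exists>(n::nat) (f :: nat \<Rightarrow> 'a \<Rightarrow> real) (a :: nat \<Rightarrow> real).
       (\<forall>i<n. continuous_linear_functional_on L (f i)) \<and>
       C = {x \<in> L. \<forall>i<n. f i x \<le> a i})"

text \<open>Intersecting with \<open>D\<close> only matters for the empty family, whose intersection is thereby read
  as \<open>D\<close>; this is also the intersection of the one-element family \<open>{D}\<close>.\<close>

definition polyhedric_in :: "'a::real_vector set \<Rightarrow> 'a set \<Rightarrow> bool"
  where "polyhedric_in C D \<longleftrightarrow>
    convex C \<and> convex D \<and> C \<subseteq> D \<and>
    (\<exists>\<H>. finite \<H> \<and>
       (\<forall>H\<in>\<H>. H \<subseteq> D \<and> convex H \<and> convex (D - H)) \<and>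
       C = D \<inter> \<Inter>\<H>)"

definition hides :: "'a::real_vector set \<Rightarrow> 'a set \<Rightarrow> bool"
  where "hides C A \<longleftrightarrow>
    A \<subseteq> UNIV - C \<and>
    (\<forall>a\<in>A. \<forall>b\<in>A. a \<noteq> b \<longrightarrow> closed_segment a b \<inter> C \<noteq> {})"

end

theory Submission
  imports Defs
begin

text \<open>
  Of the cycle (1) \<open>\<Rightarrow>\<close> (2) \<open>\<Rightarrow>\<close> (3) \<open>\<Rightarrow>\<close> (1) only the last implication is hard. Suppose that \<open>C\<close> hides no
  infinite set.

  If \<open>C\<close> had no algebraically internal point in its affine hull, every point of \<open>C\<close> could be left at
  once in some direction \<open>- c\<close> with \<open>c \<in> C\<close>. Completeness then provides a point \<open>u = (\<Sum>k. l\<^sub>k c\<^sub>k)\<close> of \<open>C\<close>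
  such that the points \<open>u - (3/2) l\<^sub>n c\<^sub>n\<close> lie outside \<open>C\<close> while their pairwise midpoints lie in \<open>C\<close>. So
  translate an internal point to \<open>0\<close>; then \<open>C = {p \<le> 1}\<close> for a sublinear gauge \<open>p\<close> on \<open>span C\<close>.

  The linear minorants of \<open>p\<close> form a pointwise compact set. Those minorants near which whole
  subdifferentials of \<open>p\<close> accumulate already determine \<open>C\<close>, by upper semicontinuity of the
  subdifferential. If there are infinitely many of them, they cluster at some \<open>f\<^sub>0\<close>, and boundary points
  with subdifferentials close to \<open>f\<^sub>0\<close>, pushed slightly outwards, form an infinite hidden set. Hence
  \<open>C = {x \<in> span C. \<forall>f\<in>F. f x \<le> 1}\<close> for a finite set \<open>F\<close>. The common kernel of \<open>F\<close> is closed because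
  its closure, being invariant under scaling, stays inside \<open>C\<close>; as it has finite codimension, \<open>span C\<close> is closed and the
  functionals in \<open>F\<close> are continuous on it.
\<close>

section \<open>The Hahn-Banach theorem for sublinear functionals\<close>

locale sublinear =
  fixes p :: "'a::real_vector \<Rightarrow> real"
  assumes subadd: "p (x + y) \<le> p x + p y"
    and pos_homogeneous: "0 \<le> t \<Longrightarrow> p (t *\<^sub>R x) = t * p x"
begin

lemma zero [simp]: "p 0 = 0"
  using pos_homogeneous[of 0 0] by simp

lemma minus_le: "- p (- x) \<le> p x"
  using subadd[of x "- x"] by simp

end

text \<open>Using the inequality with \<open>1/t\<close> at the vector \<open>t *\<^sub>R x\<close>
  supplies the reverse one, so an upper bound for positive scalars is enough.\<close>

lemma sublinearI:
  fixes p :: "'a::real_vector \<Rightarrow> real"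
  assumes "\<And>x y. p (x + y) \<le> p x + p y"
    and le: "\<And>t x. 0 < t \<Longrightarrow> p (t *\<^sub>R x) \<le> t * p x"
    and "p 0 = 0"
  shows "sublinear p"
proof
  fix t :: real and x
  assume "0 \<le> t"
  show "p (t *\<^sub>R x) = t * p x"
  proof (cases "t = 0")
    case False
    then have "t > 0" using \<open>0 \<le> t\<close> by simp
    then have "p x \<le> (1/t) * p (t *\<^sub>R x)"
      using le[of "1/t" "t *\<^sub>R x"] by simp
    then have "t * p x \<le> p (t *\<^sub>R x)"
      using \<open>t > 0\<close> by (simp add: field_simps)
    with le[OF \<open>t > 0\<close>] show ?thesis by (meson order_antisym)
  qed (simp add: assms)
qed (rule assms)

text \<open>\<open>r x\<close> is the infimum of \<open>p (x + t *\<^sub>R z) - t * p z\<close> over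
  \<open>t \<ge> 0\<close>, which \<open>- p (- x)\<close> bounds from below; \<open>t = 1\<close>
  pushes \<open>r (- z)\<close> down to \<open>- p z\<close>. This serves twice: minimal sublinear
  functionals turn out odd, and minorants can be made to touch \<open>p\<close> at a given
  point.\<close>

lemma (in sublinear) sublinear_Inf_ray:
  obtains r where "sublinear r" "\<And>x. r x \<le> p x" "r (- z) \<le> - p z"
proof -
  define R where "R x = (\<lambda>t. p (x + t *\<^sub>R z) - t * p z) ` {0..}" for x
  define r where "r x = Inf (R x)" for x
  have lower: "- p (- x) \<le> p (x + t *\<^sub>R z) - t * p z" if "0 \<le> t" for x t
    using subadd[of "x + t *\<^sub>R z" "- x"] pos_homogeneous[OF that, of z] by simp
  have bdd: "bdd_below (R x)" for x
    unfolding R_def bdd_below_def using lower by auto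
  have r_le: "r x \<le> p (x + t *\<^sub>R z) - t * p z" if "0 \<le> t" for x t
    unfolding r_def by (rule cInf_lower[OF _ bdd]) (use that in \<open>auto simp: R_def\<close>)
  have r_ge: "m \<le> r x" if "\<And>t. 0 \<le> t \<Longrightarrow> m \<le> p (x + t *\<^sub>R z) - t * p z" for m x
    unfolding r_def by (rule cInf_greatest) (use that in \<open>auto simp: R_def\<close>)
  have "sublinear r"
  proof (rule sublinearI)
    fix x y
    have "r (x + y) - (p (x + t *\<^sub>R z) - t * p z) \<le> p (y + s *\<^sub>R z) - s * p z"
      if "0 \<le> s" "0 \<le> t" for s t
      using r_le[of "s + t" "x + y"] subadd[of "x + t *\<^sub>R z" "y + s *\<^sub>R z"] that
      by (simp add: algebra_simps)
    then have "r (x + y) - (p (x + t *\<^sub>R z) - t * p z) \<le> r y" if "0 \<le> t" for t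
      using that by (intro r_ge) blast
    then have "r (x + y) - r y \<le> r x"
      by (intro r_ge) (smt (verit))
    then show "r (x + y) \<le> r x + r y" by simp
  next
    fix t :: real and x assume "0 < t"
    have "r (t *\<^sub>R x) / t \<le> p (x + s *\<^sub>R z) - s * p z" if "0 \<le> s" for s
    proof -
      have "r (t *\<^sub>R x) \<le> p (t *\<^sub>R (x + s *\<^sub>R z)) - t * s * p z"
        using r_le[of "t * s" "t *\<^sub>R x"] that \<open>0 < t\<close> by (simp add: algebra_simps)
      also have "\<dots> = t * (p (x + s *\<^sub>R z) - s * p z)"
        using \<open>0 < t\<close> pos_homogeneous[of t "x + s *\<^sub>R z"] by (simp add: right_diff_distrib)
      finally show ?thesis using \<open>0 < t\<close> by (simp add: field_simps)
    qed
    then have "r (t *\<^sub>R x) / t \<le> r x" by (rule r_ge)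
    then show "r (t *\<^sub>R x) \<le> t * r x" using \<open>0 < t\<close> by (simp add: field_simps)
  next
    have "r 0 \<le> 0" using r_le[of 0 0] by simp
    moreover have "0 \<le> r 0" by (rule r_ge) (simp add: pos_homogeneous)
    ultimately show "r 0 = 0" by simp
  qed
  moreover have "r x \<le> p x" for x using r_le[of 0 x] by simp
  moreover have "r (- z) \<le> - p z" using r_le[of 1 "- z"] by simp
  ultimately show thesis by (rule that)
qed

lemma sublinear_odd_imp_linear:
  assumes "sublinear p" and odd: "\<And>x. p (- x) \<le> - p x"
  shows "linear p"
proof
  interpret sublinear p by fact
  have neg: "p (- x) = - p x" for x
    using odd[of x] minus_le[of x] by simp
  show "p (x + y) = p x + p y" for x y
    using subadd[of x y] subadd[of "- x" "- y"] neg[of x] neg[of y] neg[of "x + y"] by simp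
  show "p (t *\<^sub>R x) = t *\<^sub>R p x" for t x
  proof (cases "0 \<le> t")
    case False
    then have "p ((- t) *\<^sub>R x) = (- t) * p x" by (intro pos_homogeneous) simp
    then show ?thesis using neg[of "t *\<^sub>R x"] by simp
  qed (simp add: pos_homogeneous)
qed

text \<open>Zorn's lemma yields a minimal sublinear functional below \<open>p\<close>. It cannot be
  lowered along any ray, hence is odd and therefore linear.\<close>

lemma (in sublinear) linear_minorant_exists:
  obtains f where "linear f" "\<And>x. f x \<le> p x"
proof -
  define A where "A = {q. sublinear q \<and> (\<forall>x. q x \<le> p x)}"
  \<comment> \<open>The order is reversed, so that a maximal element for \<open>P\<close> is a
    minimal functional.\<close>
  define P :: "('a \<Rightarrow> real) \<Rightarrow> ('a \<Rightarrow> real) \<Rightarrow> bool" where "P a b \<longleftrightarrow> b \<le> a" for a b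
  have "p \<in> A" unfolding A_def by (simp add: sublinear_axioms)
  have "\<exists>m\<in>A. \<forall>a\<in>A. P m a \<longrightarrow> a = m"
  proof (rule predicate_Zorn)
    show "partial_order_on A (relation_of P A)"
      by (rule partial_order_on_relation_ofI) (auto simp: P_def)
  next
    fix \<C> assume chain: "\<C> \<in> Chains (relation_of P A)"
    then have sub: "\<C> \<subseteq> A" and cmp: "\<And>q q'. q \<in> \<C> \<Longrightarrow> q' \<in> \<C> \<Longrightarrow> q \<le> q' \<or> q' \<le> q"
      unfolding Chains_def relation_of_def P_def by auto
    show "\<exists>u\<in>A. \<forall>a\<in>\<C>. P a u"
    proof (cases "\<C> = {}")
      case True
      then show ?thesis using \<open>p \<in> A\<close> by blast
    next
      case False
      define u where "u x = (INF q\<in>\<C>. q x)" for x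
      have sublin: "sublinear q" and q_le: "q x \<le> p x" if "q \<in> \<C>" for q x
        using that sub by (auto simp: A_def)
      have "- p (- x) \<le> q x" if "q \<in> \<C>" for q x
        using sublinear.minus_le[OF sublin[OF that], of x] q_le[OF that, of "- x"] by simp
      then have bdd: "bdd_below ((\<lambda>q. q x) ` \<C>)" for x
        by (auto simp: bdd_below_def)
      have u_le: "u x \<le> q x" if "q \<in> \<C>" for q x
        unfolding u_def by (rule cINF_lower[OF bdd that])
      have u_ge: "m \<le> u x" if "\<And>q. q \<in> \<C> \<Longrightarrow> m \<le> q x" for m x
        unfolding u_def by (rule cINF_greatest[OF False that])
      have "sublinear u"
      proof (rule sublinearI)
        fix x y
        have "u (x + y) - q x \<le> q' y" if q: "q \<in> \<C>" "q' \<in> \<C>" for q q'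
        proof -
          \<comment> \<open>In a chain the smaller of \<open>q\<close> and \<open>q'\<close> bounds
            both summands at once; this makes the pointwise infimum subadditive.\<close>
          obtain m where "m \<in> \<C>" "m \<le> q" "m \<le> q'"
            using cmp[OF q] q by auto
          then have "u (x + y) \<le> m x + m y"
            using u_le[of m "x + y"] sublinear.subadd[OF sublin, of m x y] by simp
          also have "\<dots> \<le> q x + q' y"
            using \<open>m \<le> q\<close> \<open>m \<le> q'\<close> by (simp add: le_funD add_mono)
          finally show ?thesis by simp
        qed
        then have "u (x + y) - q x \<le> u y" if "q \<in> \<C>" for q
          using that by (intro u_ge) blast
        then have "u (x + y) - u y \<le> u x"
          by (intro u_ge) (smt (verit))
        then show "u (x + y) \<le> u x + u y" by simp
      next
        fix t :: real and x assume "0 < t"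
        have "u (t *\<^sub>R x) / t \<le> q x" if "q \<in> \<C>" for q
          using u_le[OF that, of "t *\<^sub>R x"] sublinear.pos_homogeneous[OF sublin[OF that], of t x] \<open>0 < t\<close>
          by (simp add: field_simps)
        then have "u (t *\<^sub>R x) / t \<le> u x" by (rule u_ge)
        then show "u (t *\<^sub>R x) \<le> t * u x" using \<open>0 < t\<close> by (simp add: field_simps)
      next
        have "(\<lambda>q. q 0) ` \<C> = {0::real}"
          using False sublinear.zero[OF sublin] by (auto simp: image_iff)
        then show "u 0 = 0" by (simp add: u_def)
      qed
      moreover have "u x \<le> p x" for x
        using False u_le q_le by (meson ex_in_conv order_trans)
      ultimately have "u \<in> A" by (simp add: A_def)
      then show ?thesis using u_le by (auto simp: P_def le_fun_def)
    qed
  qed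
  then obtain m where "sublinear m" and m_le: "\<And>x. m x \<le> p x"
    and min: "\<And>q. sublinear q \<Longrightarrow> (\<And>x. q x \<le> p x) \<Longrightarrow> q \<le> m \<Longrightarrow> q = m"
    unfolding A_def P_def by auto
  have "m (- z) \<le> - m z" for z
  proof -
    obtain r where r: "sublinear r" "\<And>x. r x \<le> m x" "r (- z) \<le> - m z"
      using sublinear.sublinear_Inf_ray[OF \<open>sublinear m\<close>] by blast
    then have "r = m" using m_le by (intro min) (auto simp: le_fun_def intro: order_trans)
    with r(3) show ?thesis by simp
  qed
  then have "linear m" by (rule sublinear_odd_imp_linear[OF \<open>sublinear m\<close>])
  then show thesis using that m_le by blast
qed

text \<open>A linear minorant of the functional lowered along the ray of \<open>x\<close> satisfies
  \<open>f (- x) \<le> - p x\<close>, that is \<open>p x \<le> f x\<close>.\<close>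

theorem (in sublinear) linear_minorant_at:
  obtains f where "linear f" "\<And>y. f y \<le> p y" "f x = p x"
proof -
  obtain r where r: "sublinear r" "\<And>y. r y \<le> p y" "r (- x) \<le> - p x"
    using sublinear_Inf_ray by blast
  obtain f where f: "linear f" "\<And>y. f y \<le> r y"
    using sublinear.linear_minorant_exists[OF r(1)] by blast
  have le: "f y \<le> p y" for y using f(2)[of y] r(2)[of y] by simp
  have "p x \<le> f x" using f(2)[of "- x"] r(3) linear_neg[OF f(1), of x] by simp
  with le[of x] have "f x = p x" by simp
  then show thesis using that f(1) le by blast
qed

section \<open>Accessible minorants of a gauge\<close>

context sublinear
begin

text \<open>The (algebraic) subdifferential of \<open>p\<close> at 0.\<close>

definition minorants :: "('a \<Rightarrow> real) set"
  where "minorants = {f. linear f \<and> (\<forall>x. f x \<le> p x)}"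

text \<open>For sublinear \<open>p\<close> this is the usual subdifferential at \<open>x\<close>:
  the condition \<open>f y - f x \<le> p y - p x\<close> for all \<open>y\<close> forces
  \<open>f x = p x\<close>, by \<open>y = 0\<close> and \<open>y = 2 *\<^sub>R x\<close>.\<close>

definition subdiff :: "'a \<Rightarrow> ('a \<Rightarrow> real) set"
  where "subdiff x = {f \<in> minorants. f x = p x}"

text \<open>Accessible minorants replace the gradients of \<open>p\<close> at its points of smoothness, which may not
  exist in infinite dimension.\<close>

definition accessible :: "('a \<Rightarrow> real) set"
  where "accessible = {f \<in> minorants. \<forall>W. \<forall>\<epsilon>>0. finite W \<longrightarrow>
     (\<exists>x. p x > 0 \<and> (\<forall>g\<in>subdiff x. \<forall>w\<in>W. \<bar>g w - f w\<bar> < \<epsilon>))}"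

lemma minorantsD: "f \<in> minorants \<Longrightarrow> linear f" "f \<in> minorants \<Longrightarrow> f x \<le> p x"
  by (auto simp: minorants_def)

lemma subdiffD: "f \<in> subdiff x \<Longrightarrow> f \<in> minorants" "f \<in> subdiff x \<Longrightarrow> f x = p x"
  by (auto simp: subdiff_def)

lemma accessibleD:
  assumes "f \<in> accessible" "finite W" "0 < \<epsilon>"
  shows "\<exists>x. 0 < p x \<and> (\<forall>g\<in>subdiff x. \<forall>w\<in>W. \<bar>g w - f w\<bar> < \<epsilon>)"
  using assms by (simp add: accessible_def)

lemma subdiff_nonempty: "subdiff x \<noteq> {}"
  using linear_minorant_at[of x] unfolding subdiff_def minorants_def by blast

lemma subdiff_scaleR:
  assumes "0 < c"
  shows "subdiff (c *\<^sub>R x) = subdiff x"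
  using assms by (auto simp: subdiff_def minorants_def linear_scale pos_homogeneous)

section \<open>Compactness of the minorants and semicontinuity of subdifferentials\<close>

lemmas eval_intros = continuous_on_product_coordinates continuous_on_const
  continuous_on_add continuous_on_diff continuous_on_mult continuous_on_rabs

text \<open>Tychonoff: in the topology of pointwise convergence the minorants are a closed part of
  the product of the intervals \<open>{- p (- x)..p x}\<close>.\<close>

lemma compact_minorants: "compact minorants"
proof -
  have "compact (PiE UNIV (\<lambda>x. {- p (- x)..p x}))"
    using compactin_PiE[of "\<lambda>_. euclideanreal" UNIV "\<lambda>x. {- p (- x)..p x}"]
    by (simp add: euclidean_product_topology)
  moreover have "closed {f :: 'a \<Rightarrow> real. linear f}"
  proof -
    have "{f :: 'a \<Rightarrow> real. linear f} =
        (\<Inter>x. \<Inter>y. {f. f (x + y) = f x + f y}) \<inter> (\<Inter>c. \<Inter>x. {f. f (c *\<^sub>R x) = c * f x})"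
      by (auto simp: linear_iff)
    then show ?thesis
      by (auto intro!: closed_INT closed_Int closed_Collect_eq eval_intros)
  qed
  ultimately have "compact (PiE UNIV (\<lambda>x. {- p (- x)..p x}) \<inter> {f :: 'a \<Rightarrow> real. linear f})"
    by (rule compact_Int_closed)
  moreover have "minorants = PiE UNIV (\<lambda>x. {- p (- x)..p x}) \<inter> {f. linear f}"
  proof -
    have "- p (- x) \<le> f x" if "linear f" "\<forall>x. f x \<le> p x" for f x
      using that(2)[rule_format, of "- x"] linear_neg[OF that(1), of x] by simp
    then show ?thesis by (auto simp: minorants_def)
  qed
  ultimately show ?thesis by simp
qed

lemma compact_subdiff: "compact (subdiff x)"
proof -
  have "subdiff x = minorants \<inter> {f. f x = p x}"
    by (auto simp: subdiff_def)
  moreover have "closed {f :: 'a \<Rightarrow> real. f x = p x}"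
    by (intro closed_Collect_eq eval_intros)
  ultimately show ?thesis using compact_minorants by (simp add: compact_Int_closed)
qed

text \<open>Upper semicontinuity by compactness. Minorants that nearly attain \<open>p x\<close> but
  stay far from \<open>subdiff x\<close> on \<open>W\<close> would accumulate at one that attains
  \<open>p x\<close>; this one lies in \<open>subdiff x\<close> and would be far from
  itself.\<close>

lemma near_subdiff:
  assumes "finite W" "0 < \<epsilon>"
  shows "\<exists>\<delta>>0. \<forall>g\<in>minorants. p x - \<delta> \<le> g x \<longrightarrow> (\<exists>f\<in>subdiff x. \<forall>w\<in>W. \<bar>g w - f w\<bar> < \<epsilon>)"
proof (rule ccontr)
  assume contra: "\<not> ?thesis"
  then have far: "\<exists>g\<in>minorants. p x - \<delta> \<le> g x \<and> \<not> (\<exists>f\<in>subdiff x. \<forall>w\<in>W. \<bar>g w - f w\<bar> < \<epsilon>)"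
    if "0 < \<delta>" for \<delta>
    using that by blast
  \<comment> \<open>Finiteness of \<open>W\<close> keeps the union, and so \<open>N\<close>, closed.
    The sets \<open>T n\<close> decrease, so finitely many of them contain the one of largest
    index.\<close>
  define N where "N = (\<Inter>f\<in>subdiff x. \<Union>w\<in>W. {g. \<epsilon> \<le> \<bar>g w - f w\<bar>})"
  define T where "T n = {g :: 'a \<Rightarrow> real. p x - 1 / Suc n \<le> g x}" for n
  have "closed N"
    unfolding N_def using \<open>finite W\<close>
    by (auto intro!: closed_INT closed_UN closed_Collect_le eval_intros)
  then have "compact (minorants \<inter> N)"
    by (intro compact_Int_closed compact_minorants)
  moreover have "closed (T n)" for n
    unfolding T_def by (intro closed_Collect_le eval_intros)
  moreover have "minorants \<inter> N \<inter> (\<Inter>n\<in>I. T n) \<noteq> {}" if "finite I" for I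
  proof -
    obtain m where m: "\<And>n. n \<in> I \<Longrightarrow> n \<le> m"
      using \<open>finite I\<close> Max_ge by blast
    have "1 / Suc m > (0::real)" by simp
    then obtain g where g: "g \<in> minorants" "p x - 1 / Suc m \<le> g x"
      "\<not> (\<exists>f\<in>subdiff x. \<forall>w\<in>W. \<bar>g w - f w\<bar> < \<epsilon>)"
      using far by blast
    have "g \<in> T n" if "n \<in> I" for n
    proof -
      have "1 / Suc m \<le> (1 / Suc n :: real)"
        using m[OF that] by (intro divide_left_mono) auto
      then show ?thesis using g(2) by (simp add: T_def)
    qed
    moreover have "g \<in> N" using g(3) by (force simp: N_def not_less)
    ultimately show ?thesis using g(1) by blast
  qed
  ultimately have "minorants \<inter> N \<inter> (\<Inter>n. T n) \<noteq> {}"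
    by (rule compact_imp_fip_image)
  then obtain g where g: "g \<in> minorants" "g \<in> N" "\<And>n. g \<in> T n" by blast
  have "p x \<le> g x"
  proof (rule field_le_epsilon)
    fix e :: real assume "0 < e"
    then obtain n where "1 / Suc n < e" using nat_approx_posE by metis
    with g(3)[of n] show "p x \<le> g x + e" by (simp add: T_def)
  qed
  with minorantsD(2)[OF g(1), of x] have "g \<in> subdiff x"
    using g(1) by (simp add: subdiff_def)
  with g(2) show False using \<open>0 < \<epsilon>\<close> by (auto simp: N_def)
qed

text \<open>For small \<open>t\<close>, subgradients at \<open>x + t *\<^sub>R z\<close> nearly
  attain \<open>p\<close> at \<open>x\<close> itself, so \<open>near_subdiff\<close> applies to
  them.\<close>

lemma subdiff_perturb:
  assumes "finite W" "0 < \<epsilon>"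
  obtains \<eta> where "0 < \<eta>"
    "\<And>t g. 0 < t \<Longrightarrow> t < \<eta> \<Longrightarrow> g \<in> subdiff (x + t *\<^sub>R z) \<Longrightarrow>
       \<exists>f\<in>subdiff x. \<forall>w\<in>W. \<bar>g w - f w\<bar> < \<epsilon>"
proof -
  obtain \<delta> where \<delta>: "0 < \<delta>"
    "\<And>g. g \<in> minorants \<Longrightarrow> p x - \<delta> \<le> g x \<Longrightarrow> \<exists>f\<in>subdiff x. \<forall>w\<in>W. \<bar>g w - f w\<bar> < \<epsilon>"
    using near_subdiff[OF assms] by blast
  \<comment> \<open>\<open>g x\<close> falls short of \<open>p x\<close> by at most
    \<open>t * (p z + p (- z))\<close>; the summand 1 makes the divisor positive.\<close>
  define M where "M = p z + p (- z) + 1"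
  have "M > 0" using minus_le[of z] by (simp add: M_def)
  have "\<exists>f\<in>subdiff x. \<forall>w\<in>W. \<bar>g w - f w\<bar> < \<epsilon>"
    if t: "0 < t" "t < \<delta> / M" and g: "g \<in> subdiff (x + t *\<^sub>R z)" for t g
  proof (rule \<delta>(2))
    show "g \<in> minorants" using g by (rule subdiffD)
    then have "g z \<le> p z" and lin: "linear g" by (auto dest: minorantsD)
    have "p x \<le> p (x + t *\<^sub>R z) + t * p (- z)"
      using subadd[of "x + t *\<^sub>R z" "t *\<^sub>R (- z)"] pos_homogeneous[of t "- z"] t by simp
    moreover have "p (x + t *\<^sub>R z) = g x + t * g z"
      using subdiffD(2)[OF g] by (simp add: linear_add[OF lin] linear_scale[OF lin])
    moreover have "t * g z \<le> t * p z" using \<open>g z \<le> p z\<close> t by simp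
    moreover have "t * M \<le> \<delta>" using t \<open>M > 0\<close> by (simp add: field_simps)
    moreover have "t * M = t * p z + t * p (- z) + t" by (simp add: M_def algebra_simps)
    ultimately show "p x - \<delta> \<le> g x" using t by linarith
  qed
  then show thesis using that[of "\<delta> / M"] \<open>M > 0\<close> \<delta>(1) by simp
qed

text \<open>Monotonicity of the subdifferential: \<open>g\<close> is largest among the minorants at
  \<open>x + t *\<^sub>R z\<close>, \<open>f\<close> is largest at \<open>x\<close>, and subtracting
  leaves the values at \<open>z\<close>.\<close>

lemma subdiff_mono:
  assumes "0 < t" "g \<in> subdiff (x + t *\<^sub>R z)" "f \<in> subdiff x"
  shows "f z \<le> g z"
proof -
  have lin: "linear f" "linear g" using assms by (auto dest: subdiffD minorantsD)
  have "f (x + t *\<^sub>R z) \<le> g (x + t *\<^sub>R z)" "g x \<le> f x"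
    using assms by (auto simp: subdiff_def minorants_def)
  then have "t * f z \<le> t * g z"
    by (simp add: linear_add[OF lin(1)] linear_add[OF lin(2)] linear_scale[OF lin(1)] linear_scale[OF lin(2)])
  then show ?thesis using assms(1) by simp
qed

text \<open>A substitute for differentiability: the whole subdifferential at \<open>x'\<close> is
  nearly a single functional on \<open>Z\<close>. The vectors of \<open>Z\<close> are treated one at
  a time; after a short step in direction \<open>z\<close>, only subgradients remain whose value at
  \<open>z\<close> is nearly the largest available before.\<close>

lemma small_oscillation:
  assumes "finite Z"
  shows "0 < p x \<Longrightarrow> finite W \<Longrightarrow> 0 < \<epsilon> \<Longrightarrow>
    \<exists>x'. 0 < p x' \<and> (\<forall>g\<in>subdiff x'. \<exists>f\<in>subdiff x. \<forall>w\<in>W. \<bar>g w - f w\<bar> < \<epsilon>) \<and>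
      (\<forall>g\<in>subdiff x'. \<forall>g'\<in>subdiff x'. \<forall>z\<in>Z. \<bar>g z - g' z\<bar> < \<epsilon>)"
  using assms
proof (induction Z arbitrary: W \<epsilon>)
  case empty
  then show ?case by (intro exI[of _ x]) (auto intro!: bexI)
next
  case (insert z Z)
  \<comment> \<open>\<open>V\<close> enlarges \<open>W\<close> so that the approximations also
    control the value at \<open>z\<close> and preserve the small oscillation on \<open>Z\<close>
    during the next step.\<close>
  define V where "V = insert z (Z \<union> W)"
  have "finite V" using insert by (simp add: V_def)
  obtain y where y: "0 < p y" "\<And>g. g \<in> subdiff y \<Longrightarrow> \<exists>f\<in>subdiff x. \<forall>w\<in>V. \<bar>g w - f w\<bar> < \<epsilon>/3"
    "\<And>g g' v. g \<in> subdiff y \<Longrightarrow> g' \<in> subdiff y \<Longrightarrow> v \<in> Z \<Longrightarrow> \<bar>g v - g' v\<bar> < \<epsilon>/3"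
    using insert.IH[of V "\<epsilon>/3"] \<open>finite V\<close> insert.prems by (auto 0 3)
  obtain \<eta> where \<eta>: "0 < \<eta>" "\<And>t g. 0 < t \<Longrightarrow> t < \<eta> \<Longrightarrow> g \<in> subdiff (y + t *\<^sub>R z) \<Longrightarrow>
       \<exists>f\<in>subdiff y. \<forall>w\<in>V. \<bar>g w - f w\<bar> < \<epsilon>/3"
    using subdiff_perturb[of V "\<epsilon>/3" y z] \<open>finite V\<close> insert.prems by auto
  \<comment> \<open>\<open>p\<close> drops by at most \<open>t * p (- z)\<close> along the step, so
    \<open>t < \<tau>\<close> keeps it positive.\<close>
  define \<tau> where "\<tau> = p y / (1 + \<bar>p (- z)\<bar>)"
  define t where "t = min \<eta> \<tau> / 2"
  have "0 < \<tau>" using y(1) by (simp add: \<tau>_def)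
  then have t: "0 < t" "t < \<eta>" "t < \<tau>" using \<eta>(1) by (auto simp: t_def min_def)
  have "t * (1 + \<bar>p (- z)\<bar>) < p y"
    using t(3) unfolding \<tau>_def by (simp add: field_simps)
  moreover have "t * p (- z) \<le> t * (1 + \<bar>p (- z)\<bar>)" using t by (intro mult_left_mono) auto
  moreover have "p y \<le> p (y + t *\<^sub>R z) + t * p (- z)"
    using subadd[of "y + t *\<^sub>R z" "t *\<^sub>R (- z)"] pos_homogeneous[of t "- z"] t by simp
  ultimately have pos: "0 < p (y + t *\<^sub>R z)" by simp
  have near: "\<exists>f\<in>subdiff y. \<forall>w\<in>V. \<bar>g w - f w\<bar> < \<epsilon>/3" if "g \<in> subdiff (y + t *\<^sub>R z)" for g
    using \<eta>(2)[OF t(1,2) that] .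
  have "\<exists>f\<in>subdiff x. \<forall>w\<in>W. \<bar>g w - f w\<bar> < \<epsilon>" if g: "g \<in> subdiff (y + t *\<^sub>R z)" for g
  proof -
    obtain h where h: "h \<in> subdiff y" "\<And>w. w \<in> V \<Longrightarrow> \<bar>g w - h w\<bar> < \<epsilon>/3"
      using near[OF g] by blast
    obtain f where f: "f \<in> subdiff x" "\<And>w. w \<in> V \<Longrightarrow> \<bar>h w - f w\<bar> < \<epsilon>/3"
      using y(2)[OF h(1)] by blast
    have "\<bar>g w - f w\<bar> < \<epsilon>" if "w \<in> W" for w
    proof -
      have "w \<in> V" using that by (simp add: V_def)
      then show ?thesis using f(2)[of w] h(2)[of w] \<open>0 < \<epsilon>\<close> by linarith
    qed
    then show ?thesis using f(1) by blast
  qed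
  moreover have "\<bar>g v - g' v\<bar> < \<epsilon>"
    if g: "g \<in> subdiff (y + t *\<^sub>R z)" "g' \<in> subdiff (y + t *\<^sub>R z)" and v: "v \<in> insert z Z" for g g' v
  proof -
    obtain h where h: "h \<in> subdiff y" "\<And>w. w \<in> V \<Longrightarrow> \<bar>g w - h w\<bar> < \<epsilon>/3"
      using near[OF g(1)] by blast
    obtain h' where h': "h' \<in> subdiff y" "\<And>w. w \<in> V \<Longrightarrow> \<bar>g' w - h' w\<bar> < \<epsilon>/3"
      using near[OF g(2)] by blast
    show ?thesis
    proof (cases "v = z")
      case True
      \<comment> \<open>Monotonicity gives \<open>h' z \<le> g z\<close> and
        \<open>h z \<le> g' z\<close>. Hence
        \<open>g z < h z + \<epsilon>/3 \<le> g' z + \<epsilon>/3\<close>, and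
        symmetrically.\<close>
      have "z \<in> V" by (simp add: V_def)
      then have "\<bar>g z - h z\<bar> < \<epsilon>/3" "\<bar>g' z - h' z\<bar> < \<epsilon>/3" using h(2) h'(2) by auto
      then have "\<bar>g z - g' z\<bar> < \<epsilon>"
        using subdiff_mono[OF t(1) g(1) h'(1)] subdiff_mono[OF t(1) g(2) h(1)] \<open>0 < \<epsilon>\<close>
        by linarith
      then show ?thesis using True by simp
    next
      case False
      then have "v \<in> Z" "v \<in> V" using v by (auto simp: V_def)
      then show ?thesis
        using y(3)[OF h(1) h'(1), of v] h(2)[of v] h'(2)[of v] by linarith
    qed
  qed
  ultimately show ?case using pos by blast
qed

text \<open>Otherwise each \<open>f\<close> in \<open>subdiff x\<close> has a neighbourhood
  containing no whole subdifferential at a point of positive gauge. By compactness finitely many of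
  them, at half size, cover \<open>subdiff x\<close>; a point with small oscillation on all their
  test vectors then has its subdifferential inside one of them.\<close>

lemma accessible_support:
  assumes "0 < p x"
  shows "\<exists>f\<in>accessible. f x = p x"
proof (rule ccontr)
  assume contra: "\<not> ?thesis"
  have "\<exists>W \<epsilon>. finite W \<and> 0 < \<epsilon> \<and>
      \<not> (\<exists>y. p y > 0 \<and> (\<forall>g\<in>subdiff y. \<forall>w\<in>W. \<bar>g w - f w\<bar> < \<epsilon>))" if "f \<in> subdiff x" for f
    using that contra unfolding accessible_def subdiff_def by blast
  then obtain W \<epsilon> where W: "\<And>f. f \<in> subdiff x \<Longrightarrow> finite (W f)" "\<And>f. f \<in> subdiff x \<Longrightarrow> 0 < (\<epsilon> f :: real)"
    and far: "\<And>f y. f \<in> subdiff x \<Longrightarrow> p y > 0 \<Longrightarrow> \<exists>g\<in>subdiff y. \<exists>w\<in>W f. \<epsilon> f \<le> \<bar>g w - f w\<bar>"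
    by (metis not_less)
  define U where "U f = (\<Inter>w\<in>W f. {g :: 'a \<Rightarrow> real. \<bar>g w - f w\<bar> < \<epsilon> f / 2})" for f
  have "open (U f)" if "f \<in> subdiff x" for f
    unfolding U_def using W(1)[OF that]
    by (intro open_INT ballI open_Collect_less eval_intros)
  moreover have "subdiff x \<subseteq> (\<Union>f\<in>subdiff x. U f)"
    using W(2) by (auto simp: U_def)
  ultimately obtain D where D: "D \<subseteq> subdiff x" "finite D" "subdiff x \<subseteq> (\<Union>f\<in>D. U f)"
    using compactE_image[OF compact_subdiff, of "subdiff x" U x] by metis
  define V where "V = (\<Union>f\<in>D. W f)"
  \<comment> \<open>Two distances below \<open>e/2\<close> and one below
    \<open>\<epsilon> h / 2\<close> add up to less than \<open>\<epsilon> h\<close>. The entry 1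
    makes the set under the minimum nonempty.\<close>
  define e where "e = Min (insert 1 ((\<lambda>f. \<epsilon> f / 2) ` D))"
  have "finite V" using D W by (auto simp: V_def)
  have "0 < e" using D W(2) by (auto simp: e_def Min_gr_iff)
  have e_le: "e \<le> \<epsilon> f / 2" if "f \<in> D" for f
    unfolding e_def by (rule Min_le) (use D(2) that in auto)
  obtain y where y: "0 < p y" "\<forall>g\<in>subdiff y. \<exists>f\<in>subdiff x. \<forall>w\<in>V. \<bar>g w - f w\<bar> < e/2"
    "\<forall>g\<in>subdiff y. \<forall>g'\<in>subdiff y. \<forall>z\<in>V. \<bar>g z - g' z\<bar> < e/2"
    using small_oscillation[OF \<open>finite V\<close> assms \<open>finite V\<close>, of "e/2"] \<open>0 < e\<close> by auto
  obtain g where g: "g \<in> subdiff y" using subdiff_nonempty by blast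
  then obtain f where f: "f \<in> subdiff x" "\<forall>w\<in>V. \<bar>g w - f w\<bar> < e/2" using y(2) by blast
  then obtain h where h: "h \<in> D" "f \<in> U h" using D by blast
  obtain g' w where g': "g' \<in> subdiff y" and w: "w \<in> W h" "\<epsilon> h \<le> \<bar>g' w - h w\<bar>"
    using far[of h y] h(1) D(1) y(1) by blast
  have "w \<in> V" using w(1) h(1) by (auto simp: V_def)
  then have "\<bar>g' w - g w\<bar> < e/2" "\<bar>g w - f w\<bar> < e/2" using y(3) g g' f(2) by auto
  moreover have "\<bar>f w - h w\<bar> < \<epsilon> h / 2" using h(2) w(1) by (simp add: U_def)
  ultimately show False using w(2) e_le[OF h(1)] by linarith
qed

section \<open>Hidden sets from infinitely many accessible minorants\<close>

text \<open>The hypothesis makes the directional derivative of \<open>p\<close> at \<open>x\<close>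
  towards \<open>a\<close> negative. A subgradient \<open>g\<close> just past \<open>x\<close> still
  has \<open>g (a - x) < 0\<close>, so \<open>p\<close> has already dropped there.\<close>

lemma segment_enters:
  assumes "0 < \<eta>" and sub: "\<And>g. g \<in> subdiff x \<Longrightarrow> g a \<le> p x - \<eta>"
  obtains \<theta> where "0 < \<theta>" "\<theta> < 1" "p ((1 - \<theta>) *\<^sub>R x + \<theta> *\<^sub>R a) < p x"
proof -
  obtain \<delta> where \<delta>: "0 < \<delta>" "\<And>t g. 0 < t \<Longrightarrow> t < \<delta> \<Longrightarrow> g \<in> subdiff (x + t *\<^sub>R (a - x)) \<Longrightarrow>
       \<exists>f\<in>subdiff x. \<forall>w\<in>{a - x}. \<bar>g w - f w\<bar> < \<eta>"
    using subdiff_perturb[of "{a - x}" \<eta> x "a - x"] assms(1) by auto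
  define \<theta> where "\<theta> = min \<delta> 1 / 2"
  have \<theta>: "0 < \<theta>" "\<theta> < 1" "\<theta> < \<delta>" using \<delta>(1) by (auto simp: \<theta>_def min_def)
  obtain g where g: "g \<in> subdiff (x + \<theta> *\<^sub>R (a - x))" using subdiff_nonempty by blast
  then obtain f where f: "f \<in> subdiff x" "\<bar>g (a - x) - f (a - x)\<bar> < \<eta>"
    using \<delta>(2)[OF \<theta>(1,3)] by blast
  have lin: "linear f" "linear g" using f(1) g by (auto dest: subdiffD minorantsD)
  have "f (a - x) \<le> - \<eta>"
    using sub[OF f(1)] subdiffD(2)[OF f(1)] by (simp add: linear_diff[OF lin(1)])
  then have "g (a - x) < 0" using f(2) by linarith
  then have "\<theta> * g (a - x) < 0" using \<theta>(1) by (simp add: mult_pos_neg)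
  then have "p (x + \<theta> *\<^sub>R (a - x)) < g x"
    using subdiffD(2)[OF g] by (simp add: linear_add[OF lin(2)] linear_scale[OF lin(2)])
  also have "g x \<le> p x" using g by (auto dest: subdiffD minorantsD)
  finally have "p ((1 - \<theta>) *\<^sub>R x + \<theta> *\<^sub>R a) < p x" by (simp add: algebra_simps)
  then show thesis using that \<theta> by blast
qed

text \<open>Points are chosen one after another. As \<open>f0\<close> is below 1 at the earlier
  ones, so is some accessible \<open>f\<close> near \<open>f0\<close>, and so are all subgradients
  at a boundary point \<open>x\<close> whose subdifferential is close to \<open>f\<close>. Every
  segment from \<open>x\<close> to an earlier point thus enters the region \<open>p < 1\<close>, and
  still meets the set after \<open>x\<close> is pushed out slightly.\<close>

lemma infinite_accessible_hides:
  assumes "infinite accessible"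
  shows "\<exists>A. infinite A \<and> hides {x. p x \<le> 1} A"
proof -
  have "accessible \<subseteq> minorants" by (auto simp: accessible_def)
  then obtain f0 where f0: "f0 \<in> minorants" "f0 islimpt accessible"
    using Heine_Borel_imp_Bolzano_Weierstrass[OF compact_minorants assms] by blast
  \<comment> \<open>The invariant \<open>f0 a < 1\<close> permits the next choice: it is an open
    condition on the functional, so it passes to accessible ones near \<open>f0\<close>.\<close>
  define P where "P A n a \<longleftrightarrow> f0 a < 1 \<and> 1 < p a \<and>
      (\<forall>i<n. \<exists>y\<in>closed_segment (A i) a. p y \<le> 1)" for A :: "nat \<Rightarrow> 'a" and n a
  have "\<exists>A. \<forall>n. P A n (A n)"
  proof (rule dependent_wellorder_choice)
    show "P A n a = P B n a" if "\<And>y. y < n \<Longrightarrow> A y = B y" for A B n a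
      using that by (auto simp: P_def)
  next
    fix n and A :: "nat \<Rightarrow> 'a"
    assume "\<And>i. i < n \<Longrightarrow> P A i (A i)"
    then have less1: "\<And>i. i < n \<Longrightarrow> f0 (A i) < 1" by (simp add: P_def)
    define T where "T = (\<Inter>i<n. {g :: 'a \<Rightarrow> real. g (A i) < 1})"
    have "open T" unfolding T_def
      by (intro open_INT ballI open_Collect_less eval_intros) simp_all
    moreover have "f0 \<in> T" using less1 by (simp add: T_def)
    ultimately obtain f where f: "f \<in> accessible" "f \<in> T" "f \<noteq> f0"
      using f0(2) by (meson islimptE)
    then obtain z where z: "f z \<noteq> f0 z" by blast
    \<comment> \<open>The first entry keeps \<open>f0\<close> out of \<open>subdiff x\<close>,
      whence \<open>f0 x < 1\<close>; the others leave a gap of \<open>\<eta>\<close> below 1 for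
      all subgradients at the earlier points.\<close>
    define \<eta> where "\<eta> = Min (insert \<bar>f z - f0 z\<bar> ((\<lambda>i. (1 - f (A i)) / 2) ` {..<n}))"
    have "0 < \<eta>" using z f(2) by (auto simp: \<eta>_def T_def Min_gr_iff)
    have \<eta>_le: "\<eta> \<le> \<bar>f z - f0 z\<bar>" "\<And>i. i < n \<Longrightarrow> \<eta> \<le> (1 - f (A i)) / 2"
      unfolding \<eta>_def by (rule Min_le; auto)+
    have "finite (insert z (A ` {..<n}))" by simp
    then obtain x' where x': "0 < p x'"
      "\<forall>g\<in>subdiff x'. \<forall>w\<in>insert z (A ` {..<n}). \<bar>g w - f w\<bar> < \<eta>"
      using accessibleD[OF f(1) _ \<open>0 < \<eta>\<close>] by metis
    \<comment> \<open>Radial normalisation to \<open>p x = 1\<close>, which leaves the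
      subdifferential unchanged.\<close>
    define x where "x = (1 / p x') *\<^sub>R x'"
    have sub_x: "subdiff x = subdiff x'" using x'(1) by (simp add: x_def subdiff_scaleR)
    have "p x = 1" using x'(1) pos_homogeneous[of "1 / p x'" x'] by (simp add: x_def)
    have "f0 \<notin> subdiff x" using x'(2) \<eta>_le(1) by (auto simp: sub_x abs_minus_commute)
    then have "f0 x < 1"
      using f0(1) minorantsD(2)[OF f0(1), of x] \<open>p x = 1\<close> by (auto simp: subdiff_def)
    have "\<exists>\<theta>. 0 < \<theta> \<and> \<theta> < 1 \<and> p ((1 - \<theta>) *\<^sub>R x + \<theta> *\<^sub>R A i) < 1" if "i < n" for i
    proof -
      have "g (A i) \<le> p x - \<eta>" if "g \<in> subdiff x" for g
      proof -
        have "\<bar>g (A i) - f (A i)\<bar> < \<eta>" using x'(2) that \<open>i < n\<close> by (auto simp: sub_x)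
        then have "g (A i) - f (A i) < \<eta>" by (simp only: abs_less_iff)
        moreover have "2 * \<eta> \<le> 1 - f (A i)" using \<eta>_le(2)[OF \<open>i < n\<close>] by simp
        ultimately show ?thesis unfolding \<open>p x = 1\<close> by linarith
      qed
      then show ?thesis
        using segment_enters[OF \<open>0 < \<eta>\<close>, of x "A i"] \<open>p x = 1\<close> by metis
    qed
    then obtain \<theta> where \<theta>: "\<And>i. i < n \<Longrightarrow> 0 < \<theta> i" "\<And>i. i < n \<Longrightarrow> \<theta> i < (1::real)"
      "\<And>i. i < n \<Longrightarrow> p ((1 - \<theta> i) *\<^sub>R x + \<theta> i *\<^sub>R A i) < 1"
      by metis
    \<comment> \<open>\<open>\<kappa>\<close> has to be so small that the entered points stay in the
      set after the push and that \<open>f0\<close> remains below 1 at the pushed point.\<close>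
    have "\<forall>\<^sub>F \<kappa> in at_right 0. \<forall>i\<in>{..<n}. \<kappa> \<in> {0<..<1 - p ((1 - \<theta> i) *\<^sub>R x + \<theta> i *\<^sub>R A i)}"
      using \<theta>(3) by (intro eventually_ball_finite ballI eventually_at_right_real) auto
    moreover have "\<forall>\<^sub>F \<kappa> in at_right 0. \<kappa> \<in> {0<..<(1 - f0 x) / (1 + \<bar>f0 x\<bar>)}"
      using \<open>f0 x < 1\<close> by (intro eventually_at_right_real) simp
    ultimately have "\<forall>\<^sub>F \<kappa> in at_right 0. (\<forall>i\<in>{..<n}. \<kappa> \<in> {0<..<1 - p ((1 - \<theta> i) *\<^sub>R x + \<theta> i *\<^sub>R A i)}) \<and>
        \<kappa> \<in> {0<..<(1 - f0 x) / (1 + \<bar>f0 x\<bar>)}"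
      by (rule eventually_conj)
    from eventually_happens'[OF trivial_limit_at_right_real this]
    obtain \<kappa> :: real where \<kappa>: "\<And>i. i < n \<Longrightarrow> \<kappa> < 1 - p ((1 - \<theta> i) *\<^sub>R x + \<theta> i *\<^sub>R A i)"
      "0 < \<kappa>" "\<kappa> < (1 - f0 x) / (1 + \<bar>f0 x\<bar>)"
      by (metis greaterThanLessThan_iff lessThan_iff)
    define a where "a = (1 + \<kappa>) *\<^sub>R x"
    have "p a = 1 + \<kappa>" using \<kappa>(2) \<open>p x = 1\<close> by (simp add: a_def pos_homogeneous)
    moreover have "f0 a < 1"
    proof -
      have "\<kappa> * (1 + \<bar>f0 x\<bar>) < 1 - f0 x" using \<kappa>(3) by (simp add: field_simps)
      moreover have "\<kappa> * f0 x \<le> \<kappa> * (1 + \<bar>f0 x\<bar>)" using \<kappa>(2) by (intro mult_left_mono) auto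
      moreover have "f0 a = f0 x + \<kappa> * f0 x"
        using linear_scale[OF minorantsD(1)[OF f0(1)]] by (simp add: a_def distrib_right)
      ultimately show ?thesis by simp
    qed
    moreover have "\<exists>y\<in>closed_segment (A i) a. p y \<le> 1" if "i < n" for i
    proof
      \<comment> \<open>The point with the same parameter on the pushed segment exceeds
        \<open>?y\<close> by a multiple of \<open>x\<close> of gauge at most
        \<open>\<kappa>\<close>.\<close>
      let ?y = "(1 - \<theta> i) *\<^sub>R x + \<theta> i *\<^sub>R A i"
      show "\<theta> i *\<^sub>R A i + (1 - \<theta> i) *\<^sub>R a \<in> closed_segment (A i) a"
        using \<theta>[OF that] by (auto simp: in_segment intro!: exI[of _ "1 - \<theta> i"])
      have eq: "\<theta> i *\<^sub>R A i + (1 - \<theta> i) *\<^sub>R a = ?y + ((1 - \<theta> i) * \<kappa>) *\<^sub>R x"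
        by (simp add: a_def algebra_simps)
      have "p (?y + ((1 - \<theta> i) * \<kappa>) *\<^sub>R x) \<le> p ?y + (1 - \<theta> i) * \<kappa>"
        using subadd[of ?y "((1 - \<theta> i) * \<kappa>) *\<^sub>R x"] pos_homogeneous[of "(1 - \<theta> i) * \<kappa>" x]
          \<theta>[OF that] \<kappa>(2) \<open>p x = 1\<close> by simp
      also have "\<dots> \<le> p ?y + \<kappa>"
        using \<theta>(1)[OF that] \<kappa>(2) by (simp add: mult_le_cancel_right1)
      finally show "p (\<theta> i *\<^sub>R A i + (1 - \<theta> i) *\<^sub>R a) \<le> 1"
        using \<kappa>(1)[OF that] unfolding eq by simp
    qed
    ultimately have "P A n a" using \<kappa>(2) by (simp add: P_def)
    then show "\<exists>a. P A n a" ..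
  qed
  then obtain A where A: "\<And>n. P A n (A n)" by blast
  have out: "1 < p (A n)" for n using A[of n] by (simp add: P_def)
  have meet: "\<exists>y\<in>closed_segment (A i) (A j). p y \<le> 1" if "i \<noteq> j" for i j
  proof (cases "i < j")
    case True
    then show ?thesis using A[of j] by (simp add: P_def)
  next
    case False
    then have "\<exists>y\<in>closed_segment (A j) (A i). p y \<le> 1" using A[of i] that by (simp add: P_def)
    then show ?thesis by (simp only: closed_segment_commute[of "A i" "A j"])
  qed
  have "inj A"
  proof (rule injI, rule ccontr)
    fix i j assume "A i = A j" "i \<noteq> j"
    then show False using meet[of i j] out[of i] by auto
  qed
  then have "infinite (range A)" by (simp add: finite_image_iff)
  moreover have "hides {x. p x \<le> 1} (range A)"
    unfolding hides_def
  proof (intro conjI ballI impI subsetI)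
    show "x \<in> UNIV - {x. p x \<le> 1}" if "x \<in> range A" for x
      using out that by (auto simp: not_le)
  next
    fix a b assume "a \<in> range A" "b \<in> range A" "a \<noteq> b"
    then obtain i j where "a = A i" "b = A j" "i \<noteq> j" by blast
    then show "closed_segment a b \<inter> {x. p x \<le> 1} \<noteq> {}" using meet[of i j] by blast
  qed
  ultimately show ?thesis by blast
qed

end

section \<open>From gauges to finite systems of inequalities\<close>

lemma hidesD:
  assumes "hides C A" "a \<in> A"
  shows "a \<notin> C" "b \<in> A \<Longrightarrow> a \<noteq> b \<Longrightarrow> closed_segment a b \<inter> C \<noteq> {}"
  using assms by (auto simp: hides_def)

text \<open>The Minkowski functional of \<open>C\<close>. Its unit sublevel set might exceed
  \<open>C\<close> at points with \<open>p x = 1\<close>; \<open>radial\<close> excludes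
  that.\<close>

lemma gauge_exists:
  fixes C :: "'a::real_vector set"
  assumes "convex C" and absorbing: "\<And>x. \<exists>t>0. t *\<^sub>R x \<in> C"
    and radial: "\<And>x. (\<And>t. 0 \<le> t \<Longrightarrow> t < 1 \<Longrightarrow> t *\<^sub>R x \<in> C) \<Longrightarrow> x \<in> C"
  obtains p where "sublinear p" "C = {x. p x \<le> 1}"
proof -
  define T where "T x = {t. 0 < t \<and> (1 / t) *\<^sub>R x \<in> C}" for x
  define p where "p x = Inf (T x)" for x
  have "0 \<in> C" using absorbing[of 0] by simp
  have star: "t *\<^sub>R x \<in> C" if "x \<in> C" "0 \<le> t" "t \<le> 1" for t x
    using convexD[OF \<open>convex C\<close> that(1) \<open>0 \<in> C\<close>, of t "1 - t"] that by simp
  have up: "s' \<in> T x" if "s \<in> T x" "s \<le> s'" for s s' x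
    using star[of "(1 / s) *\<^sub>R x" "s / s'"] that by (auto simp: T_def)
  have ne: "T x \<noteq> {}" for x
  proof -
    obtain t where "t > 0" "t *\<^sub>R x \<in> C" using absorbing by blast
    then have "1 / t \<in> T x" by (simp add: T_def)
    then show ?thesis by blast
  qed
  have bdd: "bdd_below (T x)" for x by (auto simp: T_def bdd_below_def intro: exI[of _ 0])
  have p_le: "p x \<le> t" if "t \<in> T x" for x t
    unfolding p_def by (rule cInf_lower[OF that bdd])
  have p_ge: "m \<le> p x" if "\<And>t. t \<in> T x \<Longrightarrow> m \<le> t" for x m
    unfolding p_def by (rule cInf_greatest[OF ne that])
  have "sublinear p"
  proof (rule sublinearI)
    fix x y
    have sum: "s + t \<in> T (x + y)" if "s \<in> T x" "t \<in> T y" for s t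
    proof -
      have pos: "0 < s" "0 < t" using that by (auto simp: T_def)
      have "(s / (s + t)) *\<^sub>R ((1 / s) *\<^sub>R x) + (t / (s + t)) *\<^sub>R ((1 / t) *\<^sub>R y) \<in> C"
        using that pos by (intro convexD[OF \<open>convex C\<close>]) (auto simp: T_def add_divide_distrib[symmetric])
      then show ?thesis using pos by (simp add: T_def scaleR_right_distrib)
    qed
    have "p (x + y) - t \<le> p x" if "t \<in> T y" for t
      using p_le[OF sum[OF _ that]] by (intro p_ge) force
    then have "p (x + y) - p x \<le> p y" by (intro p_ge) force
    then show "p (x + y) \<le> p x + p y" by simp
  next
    fix t :: real and x assume "0 < t"
    have "p (t *\<^sub>R x) / t \<le> s" if "s \<in> T x" for s
    proof -
      have "t * s \<in> T (t *\<^sub>R x)" using that \<open>0 < t\<close> by (simp add: T_def)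
      then show ?thesis using p_le \<open>0 < t\<close> by (simp add: field_simps)
    qed
    then have "p (t *\<^sub>R x) / t \<le> p x" by (rule p_ge)
    then show "p (t *\<^sub>R x) \<le> t * p x" using \<open>0 < t\<close> by (simp add: field_simps)
  next
    have "T 0 = {0<..}" using \<open>0 \<in> C\<close> by (auto simp: T_def)
    then show "p 0 = 0" by (simp add: p_def)
  qed
  moreover have "x \<in> C \<longleftrightarrow> p x \<le> 1" for x
  proof
    assume "x \<in> C"
    then show "p x \<le> 1" by (intro p_le) (simp add: T_def)
  next
    assume "p x \<le> 1"
    show "x \<in> C"
    proof (rule radial)
      fix t :: real assume t: "0 \<le> t" "t < 1"
      show "t *\<^sub>R x \<in> C"
      proof (cases "t = 0")
        case False
        then have "p x < 1 / t" using t \<open>p x \<le> 1\<close> by (simp add: order_le_less_trans)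
        then obtain s where "s \<in> T x" "s < 1 / t"
          using p_ge[of x "1 / t"] by (meson not_less)
        then have "1 / t \<in> T x" using up[of s x "1 / t"] by simp
        then show ?thesis by (simp add: T_def)
      qed (simp add: \<open>0 \<in> C\<close>)
    qed
  qed
  ultimately show thesis using that by blast
qed

text \<open>The accessible minorants of the gauge serve as \<open>F\<close>: where
  \<open>0 < p x\<close>, one of them attains \<open>p x\<close>, and all other points belong to
  \<open>C\<close> anyway.\<close>

lemma absorbing_polyhedral:
  fixes C :: "'a::real_vector set"
  assumes "convex C" "\<And>x. \<exists>t>0. t *\<^sub>R x \<in> C"
    and "\<And>x. (\<And>t. 0 \<le> t \<Longrightarrow> t < 1 \<Longrightarrow> t *\<^sub>R x \<in> C) \<Longrightarrow> x \<in> C"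
    and no_hidden: "\<not> (\<exists>A. infinite A \<and> hides C A)"
  obtains F where "finite F" "\<And>f. f \<in> F \<Longrightarrow> linear f" "C = {x. \<forall>f\<in>F. f x \<le> (1::real)}"
proof -
  obtain p where "sublinear p" and C: "C = {x. p x \<le> 1}"
    using gauge_exists[OF assms(1-3)] by blast
  interpret sublinear p by fact
  have "finite accessible" using infinite_accessible_hides no_hidden C by blast
  moreover have min: "f \<in> minorants" if "f \<in> accessible" for f
    using that by (simp add: accessible_def)
  moreover have "C = {x. \<forall>f\<in>accessible. f x \<le> 1}"
  proof (intro equalityI subsetI CollectI ballI)
    fix x f assume "x \<in> C" "f \<in> accessible"
    then show "f x \<le> 1" using minorantsD(2)[OF min, of f x] C by simp
  next
    fix x assume "x \<in> {x. \<forall>f\<in>accessible. f x \<le> 1}"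
    then have le: "\<And>f. f \<in> accessible \<Longrightarrow> f x \<le> 1" by simp
    have "p x \<le> 1"
    proof (cases "0 < p x")
      case True
      then show ?thesis using accessible_support le by metis
    qed simp
    then show "x \<in> C" by (simp add: C)
  qed
  ultimately show thesis using that minorantsD(1) by blast
qed

lemma relatively_absorbing_polyhedral:
  fixes C :: "'a::real_vector set"
  assumes "subspace Y" "C \<subseteq> Y" "convex C" and absorbing: "\<And>x. x \<in> Y \<Longrightarrow> \<exists>t>0. t *\<^sub>R x \<in> C"
    and radial: "\<And>x. (\<And>t. 0 \<le> t \<Longrightarrow> t < 1 \<Longrightarrow> t *\<^sub>R x \<in> C) \<Longrightarrow> x \<in> C"
    and no_hidden: "\<not> (\<exists>A. infinite A \<and> hides C A)"
  obtains F where "finite F" "\<And>f. f \<in> F \<Longrightarrow> linear f" "C = {x \<in> Y. \<forall>f\<in>F. f x \<le> (1::real)}"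
proof -
  \<comment> \<open>A purely algebraic projection onto \<open>Y\<close>.\<close>
  obtain \<pi> :: "'a \<Rightarrow> 'a" where \<pi>: "range \<pi> \<subseteq> Y" "linear \<pi>" "\<And>v. v \<in> Y \<Longrightarrow> \<pi> v = v"
    using linear_exists_left_inverse_on[OF linear_id \<open>subspace Y\<close>] by auto
  \<comment> \<open>The preimage under \<open>\<pi>\<close> is absorbing in the whole space, and \<open>\<pi>\<close> maps the sets it hides
    injectively to sets hidden behind \<open>C\<close>.\<close>
  define D where "D = \<pi> -` C"
  have in_D: "x \<in> D \<longleftrightarrow> \<pi> x \<in> C" for x by (simp add: D_def)
  have "convex D" unfolding D_def by (rule convex_linear_vimage[OF \<pi>(2) \<open>convex C\<close>])
  moreover have "\<exists>t>0. t *\<^sub>R x \<in> D" for x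
    using absorbing[of "\<pi> x"] \<pi>(1) by (auto simp: in_D linear_scale[OF \<pi>(2)])
  moreover have "x \<in> D" if "\<And>t. 0 \<le> t \<Longrightarrow> t < 1 \<Longrightarrow> t *\<^sub>R x \<in> D" for x
    using that radial[of "\<pi> x"] by (simp add: in_D linear_scale[OF \<pi>(2)])
  moreover have "\<not> (\<exists>A. infinite A \<and> hides D A)"
  proof
    assume "\<exists>A. infinite A \<and> hides D A"
    then obtain A where A: "infinite A" "hides D A" by blast
    have meet: "closed_segment (\<pi> a) (\<pi> b) \<inter> C \<noteq> {}" if ab: "a \<in> A" "b \<in> A" "a \<noteq> b" for a b
    proof -
      obtain y where "y \<in> closed_segment a b" "y \<in> D"
        using hidesD(2)[OF A(2) ab] by blast
      then show ?thesis
        using closed_segment_linear_image[OF \<pi>(2), of a b] in_D by blast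
    qed
    have out: "\<pi> a \<notin> C" if "a \<in> A" for a
      using hidesD(1)[OF A(2) that] by (simp add: in_D)
    \<comment> \<open>If two points of \<open>A\<close> had the same image, the segment between the
      images would be a single point outside \<open>C\<close>.\<close>
    have "inj_on \<pi> A"
    proof (rule inj_onI, rule ccontr)
      fix a b assume "a \<in> A" "b \<in> A" "\<pi> a = \<pi> b" "a \<noteq> b"
      then show False using meet[of a b] out[of a] by simp
    qed
    then have "infinite (\<pi> ` A)" using A(1) by (simp add: finite_image_iff)
    moreover have "hides C (\<pi> ` A)" unfolding hides_def using meet out by auto
    ultimately show False using no_hidden by blast
  qed
  ultimately obtain F where F: "finite F" "\<And>f. f \<in> F \<Longrightarrow> linear f" "D = {x. \<forall>f\<in>F. f x \<le> (1::real)}"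
    by (rule absorbing_polyhedral) blast+
  have "C = {x \<in> Y. x \<in> D}" using \<open>C \<subseteq> Y\<close> \<pi>(3) by (auto simp: in_D)
  then show thesis using that[of F] F by auto
qed

section \<open>Closed subspaces of finite codimension\<close>

lemma tendsto_scaleR_lts:
  fixes g :: "'b \<Rightarrow> 'a::linear_topological_space"
  assumes "(f \<longlongrightarrow> a) F" "(g \<longlongrightarrow> b) F"
  shows "((\<lambda>x. f x *\<^sub>R g x) \<longlongrightarrow> a *\<^sub>R b) F"
  using filterlim_compose[OF tendsto_scaleR_Pair filterlim_Pair[OF assms]] by simp

lemma continuous_on_scaleR_lts:
  fixes g :: "'b::topological_space \<Rightarrow> 'a::linear_topological_space"
  assumes "continuous_on S f" "continuous_on S g"
  shows "continuous_on S (\<lambda>x. f x *\<^sub>R g x)"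
  using assms unfolding continuous_on_def by (blast intro: tendsto_scaleR_lts)

text \<open>Extend a basis of \<open>N\<close> by \<open>x\<close> and take the coordinate of
  \<open>x\<close>.\<close>

lemma separating_linear_functional:
  fixes N :: "'a::real_vector set"
  assumes "subspace N" "x \<notin> N"
  obtains \<phi> :: "'a \<Rightarrow> real" where "linear \<phi>" "\<And>y. y \<in> N \<Longrightarrow> \<phi> y = 0" "\<phi> x = 1"
proof -
  obtain B where B: "B \<subseteq> N" "independent B" "N \<subseteq> span B"
    using maximal_independent_subset[of N] by metis
  have span: "span B = N"
    using B(1,3) span_minimal[OF B(1) \<open>subspace N\<close>] by blast
  then have "x \<notin> span B" using \<open>x \<notin> N\<close> by simp
  then have "independent (insert x B)" using B(2) by (simp add: independent_insert)
  then obtain \<phi> :: "'a \<Rightarrow> real" where \<phi>: "linear \<phi>" "\<forall>b\<in>insert x B. \<phi> b = (if b = x then 1 else 0)"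
    using linear_independent_extend[of "insert x B" "\<lambda>b. if b = x then 1 else (0::real)"] by metis
  have "\<phi> y = 0" if "y \<in> N" for y
  proof (rule linear_eq_0_on_span[OF \<phi>(1)])
    show "y \<in> span B" using that span by simp
    show "\<phi> b = 0" if "b \<in> B" for b
      using \<phi>(2) that B(1) \<open>x \<notin> N\<close> by auto
  qed
  then show thesis using that \<phi> by simp
qed

text \<open>Continuity at 0 of the coordinate along \<open>x\<close> modulo \<open>N\<close>. If
  \<open>\<epsilon> \<le> \<bar>t\<bar>\<close>, then \<open>(1 / t) *\<^sub>R y\<close> lies in
  \<open>x + N\<close>, which stays away from 0 as \<open>N\<close> is closed; yet it is a bounded
  multiple of the small vector \<open>y\<close>.\<close>

lemma coordinate_small_near_zero:
  fixes N :: "'a::linear_topological_space set"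
  assumes "closed N" "subspace N" "x \<notin> N" "0 < \<epsilon>"
  obtains U where "open U" "0 \<in> U" "\<And>y t. y \<in> U \<Longrightarrow> y - t *\<^sub>R x \<in> N \<Longrightarrow> \<bar>t\<bar> < \<epsilon>"
proof -
  define W where "W = (\<lambda>w. x - w) -` (- N)"
  have "open W" unfolding W_def using \<open>closed N\<close>
    by (intro open_vimage continuous_intros) auto
  moreover have "0 *\<^sub>R 0 \<in> W" using \<open>x \<notin> N\<close> by (simp add: W_def)
  ultimately have "\<forall>\<^sub>F q in nhds 0 \<times>\<^sub>F nhds 0. fst q *\<^sub>R snd q \<in> W"
    by (rule topological_tendstoD[OF tendsto_scaleR_Pair])
  then obtain P Q where P: "eventually P (nhds (0::real))" and Q: "eventually Q (nhds (0::'a))"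
    and PQ: "\<And>s v. P s \<Longrightarrow> Q v \<Longrightarrow> s *\<^sub>R v \<in> W"
    unfolding eventually_prod_filter by auto
  obtain \<delta> where \<delta>: "0 < \<delta>" "\<And>s. \<bar>s\<bar> < \<delta> \<Longrightarrow> P s"
    using P by (auto simp: eventually_nhds_metric dist_real_def)
  obtain V where V: "open V" "0 \<in> V" "\<And>v. v \<in> V \<Longrightarrow> Q v"
    using Q by (auto simp: eventually_nhds)
  \<comment> \<open>With this factor \<open>\<epsilon> \<le> \<bar>t\<bar>\<close> gives
    \<open>\<bar>1 / (t * c)\<bar> \<le> \<delta> / 2\<close>, so scaling
    \<open>c *\<^sub>R y\<close> by \<open>1 / (t * c)\<close> stays in \<open>W\<close>.\<close>
  define c where "c = 2 / (\<epsilon> * \<delta>)"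
  have "0 < c" using \<open>0 < \<epsilon>\<close> \<delta>(1) by (simp add: c_def)
  define U where "U = (\<lambda>y. c *\<^sub>R y) -` V"
  have "open U" unfolding U_def using V(1)
    by (intro open_vimage continuous_on_scaleR_lts continuous_intros)
  moreover have "0 \<in> U" using V(2) by (simp add: U_def)
  moreover have "\<bar>t\<bar> < \<epsilon>" if y: "y \<in> U" "y - t *\<^sub>R x \<in> N" for y t
  proof (rule ccontr)
    assume "\<not> \<bar>t\<bar> < \<epsilon>"
    then have t: "\<epsilon> \<le> \<bar>t\<bar>" "t \<noteq> 0" using \<open>0 < \<epsilon>\<close> by auto
    have "\<bar>1 / (t * c)\<bar> = \<epsilon> * \<delta> / (2 * \<bar>t\<bar>)"
      using \<open>0 < \<epsilon>\<close> \<delta>(1) by (simp add: c_def abs_mult)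
    also have "\<dots> < \<delta>"
    proof -
      have "\<epsilon> * \<delta> < 2 * \<bar>t\<bar> * \<delta>" using t \<open>0 < \<epsilon>\<close> \<delta>(1) by (intro mult_strict_right_mono) auto
      then show ?thesis using t by (simp add: field_simps)
    qed
    finally have "P (1 / (t * c))" by (rule \<delta>(2))
    moreover have "Q (c *\<^sub>R y)" using y(1) V(3) by (simp add: U_def)
    ultimately have "(1 / (t * c)) *\<^sub>R (c *\<^sub>R y) \<in> W" by (rule PQ)
    then have "(1 / t) *\<^sub>R y \<in> W" using \<open>0 < c\<close> by simp
    moreover have "x - (1 / t) *\<^sub>R y = (- 1 / t) *\<^sub>R (y - t *\<^sub>R x)"
      using t(2) by (simp add: scaleR_right_diff_distrib)
    ultimately show False
      using subspace_scale[OF \<open>subspace N\<close> y(2), of "- 1 / t"] by (simp add: W_def)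
  qed
  ultimately show thesis by (rule that)
qed

lemma mem_span_insert_iff:
  assumes "subspace N" "linear \<phi>" "\<And>y. y \<in> N \<Longrightarrow> \<phi> y = 0" "\<phi> x = (1::real)"
  shows "y \<in> span (insert x N) \<longleftrightarrow> y - \<phi> y *\<^sub>R x \<in> N"
proof -
  have "k = \<phi> y" if "y - k *\<^sub>R x \<in> N" for k
    using assms(3)[OF that] by (simp add: linear_diff[OF assms(2)] linear_scale[OF assms(2)] assms(4))
  moreover have "span N = N" using \<open>subspace N\<close> by (simp add: span_eq_iff)
  ultimately show ?thesis unfolding span_breakdown_eq by metis
qed

text \<open>The coordinate \<open>\<phi>\<close> along \<open>x\<close> is uniformly continuous on
  the span, so by completeness of the reals it converges as a limit point is approached. Subtracting
  the part along \<open>x\<close> reduces both claims to \<open>N\<close>.\<close>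

lemma closed_span_insert:
  fixes N :: "'a::linear_topological_space set"
  assumes N: "closed N" "subspace N"
  shows "closed (span (insert x N))"
    and "linear g \<Longrightarrow> continuous_on N g \<Longrightarrow> continuous_on (span (insert x N)) (g :: 'a \<Rightarrow> real)"
proof -
  define L where "L = span (insert x N)"
  have "closed L \<and> (\<forall>g :: 'a \<Rightarrow> real. linear g \<longrightarrow> continuous_on N g \<longrightarrow> continuous_on L g)"
  proof (cases "x \<in> N")
    case True
    then have "L = N" using N(2) by (simp add: L_def insert_absorb span_eq_iff)
    then show ?thesis using N(1) by simp
  next
    case False
    obtain \<phi> :: "'a \<Rightarrow> real" where \<phi>: "linear \<phi>" "\<And>y. y \<in> N \<Longrightarrow> \<phi> y = 0" "\<phi> x = 1"
      using separating_linear_functional[OF N(2) False] by blast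
    have L: "y \<in> L \<longleftrightarrow> y - \<phi> y *\<^sub>R x \<in> N" for y
      unfolding L_def by (rule mem_span_insert_iff[OF N(2) \<phi>])
    have subL: "subspace L" by (simp add: L_def)
    have small: "\<exists>U. open U \<and> 0 \<in> U \<and> (\<forall>y y'. y \<in> L \<longrightarrow> y' \<in> L \<longrightarrow> y - y' \<in> U \<longrightarrow> \<bar>\<phi> y - \<phi> y'\<bar> < \<epsilon>)"
      if \<epsilon>: "0 < \<epsilon>" for \<epsilon>
    proof -
      obtain U where U: "open U" "0 \<in> U" "\<And>y t. y \<in> U \<Longrightarrow> y - t *\<^sub>R x \<in> N \<Longrightarrow> \<bar>t\<bar> < \<epsilon>"
        using coordinate_small_near_zero[OF N False \<epsilon>] by blast
      have "\<bar>\<phi> y - \<phi> y'\<bar> < \<epsilon>" if "y \<in> L" "y' \<in> L" "y - y' \<in> U" for y y'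
        using U(3)[OF that(3), of "\<phi> (y - y')"] subspace_diff[OF subL that(1,2)] L
        by (simp add: linear_diff[OF \<phi>(1)])
      then show ?thesis using U(1,2) by blast
    qed
    have cont_\<phi>: "continuous_on L \<phi>"
      unfolding continuous_on_def
    proof (intro ballI tendstoI)
      fix y \<epsilon> assume "y \<in> L" "0 < (\<epsilon>::real)"
      obtain U where U: "open U" "0 \<in> U" "\<And>y y'. y \<in> L \<Longrightarrow> y' \<in> L \<Longrightarrow> y - y' \<in> U \<Longrightarrow> \<bar>\<phi> y - \<phi> y'\<bar> < \<epsilon>"
        using small[OF \<open>0 < \<epsilon>\<close>] by blast
      have "((\<lambda>z. z - y) \<longlongrightarrow> y - y) (at y within L)" by (intro tendsto_intros)
      then have "\<forall>\<^sub>F z in at y within L. z - y \<in> U"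
        using U(1,2) by (auto dest: topological_tendstoD)
      moreover have "\<forall>\<^sub>F z in at y within L. z \<in> L" by (auto simp: eventually_at_filter)
      ultimately show "\<forall>\<^sub>F z in at y within L. dist (\<phi> z) (\<phi> y) < \<epsilon>"
        by eventually_elim (simp add: U(3) \<open>y \<in> L\<close> dist_real_def)
    qed
    have "closed L"
      unfolding closed_limpt
    proof (intro allI impI)
      fix z assume z: "z islimpt L"
      \<comment> \<open>A filter takes the place of a sequence, since the topology need not be first
        countable.\<close>
      define F where "F = at z within L"
      have "F \<noteq> bot" using z by (simp add: F_def trivial_limit_within)
      have ev_L: "\<forall>\<^sub>F y in F. y \<in> L" by (auto simp: F_def eventually_at_filter)
      have lim: "((\<lambda>y. y) \<longlongrightarrow> z) F" by (simp add: F_def)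
      have "cauchy_filter (filtermap \<phi> F)"
        unfolding cauchy_filter_metric_filtermap
      proof (intro allI impI)
        fix \<epsilon> :: real assume "0 < \<epsilon>"
        obtain U where U: "open U" "0 \<in> U" "\<And>y y'. y \<in> L \<Longrightarrow> y' \<in> L \<Longrightarrow> y - y' \<in> U \<Longrightarrow> \<bar>\<phi> y - \<phi> y'\<bar> < \<epsilon>"
          using small[OF \<open>0 < \<epsilon>\<close>] by blast
        have "((\<lambda>q. fst q - snd q) \<longlongrightarrow> z - z) (F \<times>\<^sub>F F)"
          by (intro tendsto_diff filterlim_compose[OF lim] filterlim_fst filterlim_snd)
        then have "\<forall>\<^sub>F q in F \<times>\<^sub>F F. fst q - snd q \<in> U"
          using U(1,2) by (auto dest: topological_tendstoD)
        then obtain P where P: "eventually P F" "\<And>y y'. P y \<Longrightarrow> P y' \<Longrightarrow> y - y' \<in> U"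
          unfolding eventually_prod_same by auto
        show "\<exists>P. eventually P F \<and> (\<forall>y y'. P y \<and> P y' \<longrightarrow> dist (\<phi> y) (\<phi> y') < \<epsilon>)"
          using eventually_conj[OF P(1) ev_L] P(2) U(3)
          by (intro exI[of _ "\<lambda>y. P y \<and> y \<in> L"]) (auto simp: dist_real_def)
      qed
      then obtain t where "(\<phi> \<longlongrightarrow> t) F"
        using cauchy_filter_complete_converges[of "filtermap \<phi> F" UNIV] \<open>F \<noteq> bot\<close> complete_UNIV
        by (auto simp: filterlim_def filtermap_bot_iff)
      then have "((\<lambda>y. y - \<phi> y *\<^sub>R x) \<longlongrightarrow> z - t *\<^sub>R x) F"
        by (intro tendsto_diff lim tendsto_scaleR_lts tendsto_const)
      moreover have "\<forall>\<^sub>F y in F. y - \<phi> y *\<^sub>R x \<in> N"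
        using ev_L by eventually_elim (simp add: L)
      ultimately have "z - t *\<^sub>R x \<in> N"
        by (rule Lim_in_closed_set[OF N(1) _ \<open>F \<noteq> bot\<close>, rotated])
      then show "z \<in> L"
        unfolding L_def using span_breakdown_eq[of z x N] span_base by blast
    qed
    moreover have "continuous_on L g" if g: "linear g" "continuous_on N g" for g :: "'a \<Rightarrow> real"
    proof -
      have "continuous_on L (\<lambda>y. g (y - \<phi> y *\<^sub>R x) + \<phi> y * g x)"
        by (intro continuous_intros cont_\<phi> continuous_on_compose2[OF g(2)] continuous_on_scaleR_lts)
          (auto simp: L)
      then show ?thesis
        by (simp add: linear_diff[OF g(1)] linear_scale[OF g(1)])
    qed
    ultimately show ?thesis by blast
  qed
  then show "closed (span (insert x N))"
    and "linear g \<Longrightarrow> continuous_on N g \<Longrightarrow> continuous_on (span (insert x N)) g"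
    by (auto simp: L_def)
qed

text \<open>Dropping one functional enlarges the common kernel by at most one dimension, so finitely
  many uses of \<open>closed_span_insert\<close> climb from the kernel to \<open>Y\<close>.\<close>

lemma closed_of_closed_kernel:
  fixes Y :: "'a::linear_topological_space set"
  assumes "finite F" "\<And>f. f \<in> F \<Longrightarrow> linear f" "subspace Y"
    and "closed {x \<in> Y. \<forall>f\<in>F. f x = (0::real)}"
  shows "closed Y \<and> (\<forall>g :: 'a \<Rightarrow> real. linear g \<longrightarrow>
    continuous_on {x \<in> Y. \<forall>f\<in>F. f x = 0} g \<longrightarrow> continuous_on Y g)"
  using assms
proof (induction F)
  case (insert f F)
  define M where "M = {x \<in> Y. \<forall>f\<in>insert f F. f x = 0}"
  define M' where "M' = {x \<in> Y. \<forall>f\<in>F. f x = 0}"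
  have lin: "linear f" "\<And>h. h \<in> F \<Longrightarrow> linear h" using insert.prems by auto
  have "closed M" using insert.prems(3) by (simp only: M_def)
  have sub: "subspace M" "subspace M'"
    using insert.prems(1,2) unfolding M_def M'_def
    by (auto simp: subspace_def linear_0 linear_add linear_scale)
  have ext: "closed M' \<and> (\<forall>g :: 'a \<Rightarrow> real. linear g \<longrightarrow> continuous_on M g \<longrightarrow> continuous_on M' g)"
  proof (cases "M' = M")
    case True
    then show ?thesis using \<open>closed M\<close> by simp
  next
    case False
    then obtain x where x: "x \<in> M'" "f x \<noteq> 0" by (auto simp: M_def M'_def)
    have "M' = span (insert x M)"
    proof
      show "M' \<subseteq> span (insert x M)"
      proof
        fix y assume y: "y \<in> M'"
        have "y - (f y / f x) *\<^sub>R x \<in> M'"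
          using sub(2) x(1) y by (intro subspace_diff subspace_scale)
        moreover have "f (y - (f y / f x) *\<^sub>R x) = 0"
          using x(2) by (simp add: linear_diff[OF lin(1)] linear_scale[OF lin(1)])
        ultimately have "y - (f y / f x) *\<^sub>R x \<in> M" by (simp add: M_def M'_def)
        then show "y \<in> span (insert x M)"
          unfolding span_breakdown_eq[of y x M] using span_base by blast
      qed
      show "span (insert x M) \<subseteq> M'"
        by (rule span_minimal[OF _ sub(2)]) (use x in \<open>auto simp: M_def M'_def\<close>)
    qed
    then show ?thesis using closed_span_insert[OF \<open>closed M\<close> sub(1), where x = x] by simp
  qed
  then have "closed Y \<and> (\<forall>g :: 'a \<Rightarrow> real. linear g \<longrightarrow> continuous_on M' g \<longrightarrow> continuous_on Y g)"
    using insert.IH[OF lin(2) insert.prems(2)] by (simp add: M'_def)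
  then show ?case using ext by (simp add: M_def)
qed simp

section \<open>Convex sets without internal points\<close>

text \<open>Translation invariance gives \<open>d x y = N (x - y)\<close> with
  \<open>N x = d x 0\<close>.\<close>

lemma invariant_metric_F_norm:
  assumes "complete_linear_metric_space TYPE('a::linear_topological_space)"
  obtains N :: "'a::linear_topological_space \<Rightarrow> real"
  where "N 0 = 0" "\<And>x y. N (x + y) \<le> N x + N y" "\<And>x. N (- x) = N x"
    "\<And>U x. open U \<Longrightarrow> x \<in> U \<Longrightarrow> \<exists>r>0. \<forall>y. N (y - x) < r \<longrightarrow> y \<in> U"
    "\<And>r. open {x. N x < r}"
    "\<And>\<sigma>. \<forall>e>0. \<exists>M. \<forall>m\<ge>M. \<forall>n\<ge>M. N (\<sigma> m - \<sigma> n) < e \<Longrightarrow> \<exists>l. \<sigma> \<longlonglongrightarrow> l"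
proof -
  obtain d :: "'a \<Rightarrow> 'a \<Rightarrow> real" where "Metric_space UNIV d"
    and top: "Metric_space.mtopology UNIV d = euclidean"
    and complete: "Metric_space.mcomplete UNIV d"
    and inv: "\<And>x y z. d (x + z) (y + z) = d x y"
    using assms unfolding complete_linear_metric_space_def by blast
  interpret Metric_space UNIV d by fact
  define N where "N x = d x 0" for x
  have d: "d x y = N (x - y)" for x y
    using inv[of "x - y" y 0] by (simp add: N_def)
  have "N 0 = 0" by (simp add: N_def)
  moreover have "N (x + y) \<le> N x + N y" for x y
    using triangle[of "x + y" y 0] inv[of x y 0] by (simp add: N_def)
  moreover have "N (- x) = N x" for x
    using inv[of "- x" x 0] by (simp add: N_def commute)
  moreover have "\<exists>r>0. \<forall>y. N (y - x) < r \<longrightarrow> y \<in> U" if "open U" "x \<in> U" for U x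
  proof -
    have "openin mtopology U" using \<open>open U\<close> by (simp add: top)
    then obtain r where "0 < r" "mball x r \<subseteq> U"
      using \<open>x \<in> U\<close> unfolding openin_mtopology by blast
    then show ?thesis
      by (intro exI[of _ r] conjI) (auto simp: subset_iff commute[of x] simp flip: d)
  qed
  moreover have "open {x. N x < r}" for r
  proof -
    have "{x. N x < r} = mball 0 r" by (auto simp: N_def commute)
    then show ?thesis using openin_mball[of 0 r] by (simp add: top)
  qed
  moreover have "\<exists>l. \<sigma> \<longlonglongrightarrow> l"
    if "\<forall>e>0. \<exists>M. \<forall>m\<ge>M. \<forall>n\<ge>M. N (\<sigma> m - \<sigma> n) < e" for \<sigma>
  proof -
    have "MCauchy \<sigma>" unfolding MCauchy_def d using that by blast
    then show ?thesis using complete by (auto simp: mcomplete_def top)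
  qed
  ultimately show thesis by (rule that)
qed

text \<open>The missing weight is placed at 0.\<close>

lemma convex_subsum_mem:
  assumes "convex C" "0 \<in> C" "finite I" "\<And>i. i \<in> I \<Longrightarrow> c i \<in> C"
    and "\<And>i. i \<in> I \<Longrightarrow> 0 \<le> \<mu> i" "sum \<mu> I \<le> 1"
  shows "(\<Sum>i\<in>I. \<mu> i *\<^sub>R c i) \<in> C"
proof (cases "sum \<mu> I = 0")
  case True
  then have "\<mu> i = 0" if "i \<in> I" for i
    using sum_nonneg_eq_0_iff[OF \<open>finite I\<close>, of \<mu>] assms(5) that by auto
  then show ?thesis using \<open>0 \<in> C\<close> by simp
next
  case False
  define s where "s = sum \<mu> I"
  have s: "0 < s" "s \<le> 1" using False assms(5,6) sum_nonneg[of I \<mu>] by (auto simp: s_def)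
  have "(\<Sum>i\<in>I. (\<mu> i / s) *\<^sub>R c i) \<in> C"
    using assms s by (intro convex_sum) (auto simp: s_def simp flip: sum_divide_distrib)
  then have "s *\<^sub>R (\<Sum>i\<in>I. (\<mu> i / s) *\<^sub>R c i) + (1 - s) *\<^sub>R 0 \<in> C"
    using s \<open>0 \<in> C\<close> by (intro convexD[OF \<open>convex C\<close>]) auto
  then show ?thesis using s by (simp add: scaleR_sum_right)
qed

text \<open>Suppose a short step along \<open>- c\<close> stayed in \<open>C\<close> for every
  \<open>c\<close> in \<open>C\<close>. A step along \<open>c\<close> does so too, since
  \<open>s + (1/2) *\<^sub>R c\<close> is the midpoint of \<open>2 *\<^sub>R s\<close> and
  \<open>c\<close>. The directions with two-sided steps form a subspace, which then contains
  \<open>span C\<close> and with it \<open>v\<close>.\<close>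

lemma exit_direction:
  fixes C :: "'a::real_vector set"
  assumes "convex C" "0 \<in> C" "2 *\<^sub>R s \<in> C"
    and not_internal: "v \<in> span C" "\<And>t. 0 < t \<Longrightarrow> s + t *\<^sub>R v \<notin> C"
  shows "\<exists>c\<in>C. \<forall>t>0. s - t *\<^sub>R c \<notin> C"
proof (rule ccontr)
  assume contra: "\<not> ?thesis"
  have behind: "\<exists>t>0. s - t *\<^sub>R c \<in> C" if "c \<in> C" for c
    using contra that by blast
  have mid: "(1 / 2) *\<^sub>R x + (1 / 2) *\<^sub>R y \<in> C" if "x \<in> C" "y \<in> C" for x y
    using convexD[OF \<open>convex C\<close> that, of "1/2" "1/2"] by simp
  have "s \<in> C" using mid[OF assms(3,2)] by simp
  define G where "G = {v. \<exists>t>0. \<forall>r. \<bar>r\<bar> \<le> t \<longrightarrow> s + r *\<^sub>R v \<in> C}"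
  have "subspace G"
    unfolding subspace_def
  proof (intro conjI ballI allI)
    show "0 \<in> G" using \<open>s \<in> C\<close> by (auto simp: G_def intro: exI[of _ 1])
  next
    fix v w assume "v \<in> G" "w \<in> G"
    then obtain t1 t2 where t: "0 < t1" "0 < t2" "\<And>r. \<bar>r\<bar> \<le> t1 \<Longrightarrow> s + r *\<^sub>R v \<in> C"
      "\<And>r. \<bar>r\<bar> \<le> t2 \<Longrightarrow> s + r *\<^sub>R w \<in> C" unfolding G_def by blast
    have "s + r *\<^sub>R (v + w) \<in> C" if "\<bar>r\<bar> \<le> min t1 t2 / 2" for r
    proof -
      have "s + (2 * r) *\<^sub>R v \<in> C" "s + (2 * r) *\<^sub>R w \<in> C"
        using that by (auto intro!: t)
      from mid[OF this] have "((1/2) *\<^sub>R s + (1/2) *\<^sub>R s) + r *\<^sub>R (v + w) \<in> C"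
        by (simp add: algebra_simps)
      then show ?thesis by (simp flip: scaleR_left_distrib)
    qed
    then show "v + w \<in> G"
      using t(1,2) unfolding G_def by (intro CollectI exI[of _ "min t1 t2 / 2"]) auto
  next
    fix a v assume "v \<in> G"
    then obtain t where t: "0 < t" "\<And>r. \<bar>r\<bar> \<le> t \<Longrightarrow> s + r *\<^sub>R v \<in> C" unfolding G_def by blast
    have "s + r *\<^sub>R a *\<^sub>R v \<in> C" if "\<bar>r\<bar> \<le> t / (\<bar>a\<bar> + 1)" for r
    proof -
      have "\<bar>r\<bar> * (\<bar>a\<bar> + 1) \<le> t" using that by (simp add: pos_le_divide_eq)
      then have "\<bar>r * a\<bar> \<le> t" by (simp add: abs_mult distrib_left)
      then show ?thesis using t(2)[of "r * a"] by simp
    qed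
    then show "a *\<^sub>R v \<in> G"
      using t(1) unfolding G_def by (intro CollectI exI[of _ "t / (\<bar>a\<bar> + 1)"]) auto
  qed
  moreover have "C \<subseteq> G"
  proof
    fix c assume c: "c \<in> C"
    obtain t where t: "0 < t" "s - t *\<^sub>R c \<in> C" using behind[OF c] by blast
    have fwd: "s + (1/2) *\<^sub>R c \<in> C" using mid[OF assms(3) c] by simp
    have "s + r *\<^sub>R c \<in> C" if "\<bar>r\<bar> \<le> min t (1/2)" for r
    proof (cases "0 \<le> r")
      case True
      have "(1 - 2 * r) *\<^sub>R s + (2 * r) *\<^sub>R (s + (1/2) *\<^sub>R c) \<in> C"
        using True that by (intro convexD[OF \<open>convex C\<close> \<open>s \<in> C\<close> fwd]) auto
      then show ?thesis by (simp add: algebra_simps)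
    next
      case False
      have "(1 - (- r / t)) *\<^sub>R s + (- r / t) *\<^sub>R (s - t *\<^sub>R c) \<in> C"
        using False that t(1) by (intro convexD[OF \<open>convex C\<close> \<open>s \<in> C\<close> t(2)]) (auto simp: field_simps)
      then show ?thesis using t(1) by (simp add: algebra_simps)
    qed
    then show "c \<in> G"
      using t(1) unfolding G_def by (intro CollectI exI[of _ "min t (1/2)"]) auto
  qed
  ultimately have "v \<in> G" using span_minimal not_internal(1) by blast
  then obtain t where "0 < t" "s + t *\<^sub>R v \<in> C" unfolding G_def by force
  then show False using not_internal(2) by blast
qed

text \<open>Twice each partial sum lies in \<open>C\<close>, as \<open>exit_direction\<close>
  requires. The exit found there is recorded with a safety radius, and all later terms are chosen
  too small to undo it.\<close>

lemma no_internal_point_hides: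
  fixes C :: "'a::linear_topological_space set"
  assumes complete: "complete_linear_metric_space TYPE('a)"
    and "closed C" "convex C" "0 \<in> C"
    and no_internal: "\<And>s. s \<in> C \<Longrightarrow> \<exists>v\<in>span C. \<forall>t>0. s + t *\<^sub>R v \<notin> C"
  shows "\<exists>A. infinite A \<and> hides C A"
proof -
  obtain N :: "'a \<Rightarrow> real" where N0: "N 0 = 0" and N_add: "\<And>x y. N (x + y) \<le> N x + N y"
    and N_minus: "\<And>x. N (- x) = N x"
    and N_nhd: "\<And>U x. open U \<Longrightarrow> x \<in> U \<Longrightarrow> \<exists>r>0. \<forall>y. N (y - x) < r \<longrightarrow> y \<in> U"
    and N_open: "\<And>r. open {x. N x < r}"
    and N_complete: "\<And>\<sigma>. \<forall>e>0. \<exists>M. \<forall>m\<ge>M. \<forall>n\<ge>M. N (\<sigma> m - \<sigma> n) < e \<Longrightarrow> \<exists>l. \<sigma> \<longlonglongrightarrow> l"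
    by (rule invariant_metric_F_norm[OF complete]) (rule that)
  have N_scale: "\<forall>\<^sub>F t in at_right 0. N (t *\<^sub>R x) < \<rho>" if "0 < \<rho>" for x \<rho>
  proof -
    have "((\<lambda>t. t *\<^sub>R x) \<longlongrightarrow> 0 *\<^sub>R x) (at_right 0)"
      by (intro tendsto_scaleR_lts tendsto_const) (simp add: tendsto_ident_at)
    from topological_tendstoD[OF this N_open, of \<rho>] show ?thesis using that N0 by simp
  qed
  \<comment> \<open>Weights of total at most 1/2 leave room for doubling the partial sums.\<close>
  have geo: "(\<Sum>k<m. (1/2 :: real) ^ (k + 2)) \<le> 1/2" for m
  proof -
    have "(\<Sum>k<m. (1/2 :: real) ^ (k + 2)) = 1/2 * (1 - (1/2) ^ m)"
      by (induction m) (auto simp: field_simps)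
    then show ?thesis by simp
  qed
  \<comment> \<open>Each term \<open>(l, c, r)\<close> consists of a weight, a direction and a radius: the ball of radius \<open>r\<close>
    keeps the perturbed partial sum outside \<open>C\<close> whatever terms are added later.\<close>
  define S where "S f n = (\<Sum>i<n. fst (f i) *\<^sub>R fst (snd (f i)))" for f :: "nat \<Rightarrow> real \<times> 'a \<times> real" and n
  define P where "P f n q \<longleftrightarrow> 0 < fst q \<and> fst q \<le> (1/2) ^ (n + 2) \<and> fst (snd q) \<in> C \<and>
      0 < snd (snd q) \<and> snd (snd q) \<le> (1/2) ^ n \<and>
      (\<forall>y. N (y - (S f n - (fst q / 2) *\<^sub>R fst (snd q))) \<le> snd (snd q) \<longrightarrow> y \<notin> C) \<and>
      (\<forall>i<n. N (fst q *\<^sub>R fst (snd q)) \<le> snd (snd (f i)) * (1/2) ^ (n - i))"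
    for f :: "nat \<Rightarrow> real \<times> 'a \<times> real" and n q
  have "\<exists>f. \<forall>n. P f n (f n)"
  proof (rule dependent_wellorder_choice)
    fix f g :: "nat \<Rightarrow> real \<times> 'a \<times> real" and n q
    assume eq: "\<And>i. i < n \<Longrightarrow> f i = g i"
    then have "S f n = S g n" by (simp add: S_def)
    then show "P f n q = P g n q" using eq by (simp add: P_def)
  next
    fix n and f :: "nat \<Rightarrow> real \<times> 'a \<times> real"
    assume IH: "\<And>i. i < n \<Longrightarrow> P f i (f i)"
    have "2 *\<^sub>R S f n = (\<Sum>i<n. (2 * fst (f i)) *\<^sub>R fst (snd (f i)))"
      by (simp add: S_def scaleR_sum_right)
    also have "\<dots> \<in> C"
    proof (rule convex_subsum_mem[OF \<open>convex C\<close> \<open>0 \<in> C\<close>])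
      have "(\<Sum>i<n. fst (f i)) \<le> (\<Sum>i<n. (1/2) ^ (i + 2))"
        using IH by (intro sum_mono) (simp add: P_def)
      then show "(\<Sum>i<n. 2 * fst (f i)) \<le> 1" using geo[of n] by (simp flip: sum_distrib_left)
    qed (use IH in \<open>auto simp: P_def less_imp_le\<close>)
    finally have S2: "2 *\<^sub>R S f n \<in> C" .
    then have "S f n \<in> C"
      using convexD[OF \<open>convex C\<close> S2 \<open>0 \<in> C\<close>, of "1/2" "1/2"] by simp
    then obtain v where "v \<in> span C" "\<And>t. 0 < t \<Longrightarrow> S f n + t *\<^sub>R v \<notin> C" using no_internal by blast
    from exit_direction[OF \<open>convex C\<close> \<open>0 \<in> C\<close> S2 this]
    obtain c where c: "c \<in> C" "\<And>t. 0 < t \<Longrightarrow> S f n - t *\<^sub>R c \<notin> C" by blast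
    have "\<forall>\<^sub>F t in at_right 0. \<forall>i\<in>{..<n}. N (t *\<^sub>R c) < snd (snd (f i)) * (1/2) ^ (n - i)"
      using IH by (intro eventually_ball_finite ballI N_scale) (auto simp: P_def)
    moreover have "\<forall>\<^sub>F t in at_right 0. t \<in> {0<..<(1/2::real) ^ (n + 2)}"
      by (intro eventually_at_right_real) simp
    ultimately have "\<forall>\<^sub>F t in at_right 0. (\<forall>i\<in>{..<n}. N (t *\<^sub>R c) < snd (snd (f i)) * (1/2) ^ (n - i)) \<and>
        t \<in> {0<..<(1/2::real) ^ (n + 2)}" by (rule eventually_conj)
    from eventually_happens'[OF trivial_limit_at_right_real this]
    obtain l where l: "0 < l" "l < (1/2) ^ (n + 2)"
      "\<forall>i<n. N (l *\<^sub>R c) < snd (snd (f i)) * (1/2) ^ (n - i)" by auto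
    have "open (- C)" using \<open>closed C\<close> by (simp add: open_Compl)
    moreover have "S f n - (l / 2) *\<^sub>R c \<in> - C" using c(2) l(1) by simp
    ultimately obtain r where r: "0 < r" "\<And>y. N (y - (S f n - (l / 2) *\<^sub>R c)) < r \<Longrightarrow> y \<in> - C"
      using N_nhd by metis
    \<comment> \<open>Halving turns the open ball that avoids \<open>C\<close> into a closed one;
      the bound on the tails survives the limit only as a non-strict inequality.\<close>
    define \<rho> where "\<rho> = min (r / 2) ((1/2) ^ n)"
    have \<rho>: "0 < \<rho>" "\<rho> < r" "\<rho> \<le> (1/2) ^ n" using r(1) by (auto simp: \<rho>_def min_def)
    have "y \<notin> C" if "N (y - (S f n - (l / 2) *\<^sub>R c)) \<le> \<rho>" for y
      using r(2)[of y] that \<rho>(2) by simp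
    then have "P f n (l, c, \<rho>)"
      using l \<rho> c(1) unfolding P_def by (simp add: less_imp_le)
    then show "\<exists>q. P f n q" ..
  qed
  then obtain f where f: "\<And>n. P f n (f n)" by blast
  define l where "l n = fst (f n)" for n
  define c where "c n = fst (snd (f n))" for n
  define r where "r n = snd (snd (f n))" for n
  define s where "s n = (\<Sum>i<n. l i *\<^sub>R c i)" for n
  have "S f n = s n" for n by (simp add: S_def s_def l_def c_def)
  then have l_pos: "\<And>n. 0 < l n" and l_le: "\<And>n. l n \<le> (1/2) ^ (n + 2)" and c_in: "\<And>n. c n \<in> C"
    and r_pos: "\<And>n. 0 < r n" and r_le: "\<And>n. r n \<le> (1/2) ^ n"
    and away: "\<And>n y. N (y - (s n - (l n / 2) *\<^sub>R c n)) \<le> r n \<Longrightarrow> y \<notin> C"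
    and small: "\<And>i n. i < n \<Longrightarrow> N (l n *\<^sub>R c n) \<le> r i * (1/2) ^ (n - i)"
    using f by (auto simp: P_def l_def c_def r_def)
  \<comment> \<open>The factors \<open>(1/2) ^ (n - i)\<close> in \<open>P\<close> sum to at most 1,
    so everything added after the term \<open>i\<close> stays within its radius.\<close>
  have tail: "N (s (Suc i + j) - s (Suc i)) \<le> r i * (1 - (1/2) ^ j)" for i j
  proof (induction j)
    case (Suc j)
    have "s (Suc i + Suc j) - s (Suc i) = (s (Suc i + j) - s (Suc i)) + l (Suc i + j) *\<^sub>R c (Suc i + j)"
      by (simp add: s_def)
    then have "N (s (Suc i + Suc j) - s (Suc i)) \<le>
        N (s (Suc i + j) - s (Suc i)) + N (l (Suc i + j) *\<^sub>R c (Suc i + j))"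
      by (simp only: N_add)
    also have "\<dots> \<le> r i * (1 - (1/2) ^ j) + r i * (1/2) ^ Suc j"
      using Suc.IH small[of i "Suc i + j"] by (intro add_mono) simp_all
    also have "\<dots> = r i * (1 - (1/2) ^ Suc j)" by (simp add: field_simps)
    finally show ?case .
  qed (simp add: N0)
  have tail_le: "N (s m - s (Suc i)) \<le> r i" if im: "Suc i \<le> m" for i m
  proof -
    obtain j where "m = Suc i + j" using le_Suc_ex[OF im] by blast
    moreover have "r i * (1 - (1/2) ^ j) \<le> r i * 1" using r_pos[of i] by (intro mult_left_mono) auto
    ultimately show ?thesis using tail[of i j] by simp
  qed
  have N_diff: "N (x - z) \<le> N (x - y) + N (y - z)" for x y z
    using N_add[of "x - y" "y - z"] by simp
  have N_commute: "N (x - y) = N (y - x)" for x y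
    using N_minus[of "x - y"] by simp
  obtain u where u: "s \<longlonglongrightarrow> u"
  proof -
    have "\<exists>u. s \<longlonglongrightarrow> u"
    proof (rule N_complete, intro allI impI)
      fix e :: real assume "0 < e"
      then obtain i where i: "(1/2) ^ i < e / 2"
        using real_arch_pow_inv[of "e / 2" "1/2"] by auto
      have "N (s m - s n) < e" if "Suc i \<le> m" "Suc i \<le> n" for m n
        using N_diff[of "s m" "s n" "s (Suc i)"] tail_le[OF that(1)] tail_le[OF that(2)]
          N_commute[of "s (Suc i)" "s n"] r_le[of i] i by linarith
      then show "\<exists>M. \<forall>m\<ge>M. \<forall>n\<ge>M. N (s m - s n) < e" by blast
    qed
    then show thesis using that by blast
  qed
  have u_tail: "N (u - s (Suc i)) \<le> r i" for i
  proof (rule field_le_epsilon)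
    fix e :: real assume "0 < e"
    have "(\<lambda>m. u - s m) \<longlonglongrightarrow> u - u" by (intro tendsto_intros u)
    from topological_tendstoD[OF this N_open, of e] have "\<forall>\<^sub>F m in sequentially. N (u - s m) < e"
      using \<open>0 < e\<close> N0 by simp
    then have "\<forall>\<^sub>F m in sequentially. N (u - s m) < e \<and> Suc i \<le> m"
      using eventually_ge_at_top by (rule eventually_conj)
    then obtain m where "N (u - s m) < e" "Suc i \<le> m"
      using eventually_happens by fastforce
    then show "N (u - s (Suc i)) \<le> r i + e"
      using N_diff[of u "s (Suc i)" "s m"] tail_le[of i m] by linarith
  qed
  \<comment> \<open>Up to the tail \<open>u - s (Suc n)\<close>, \<open>a n\<close> is the recorded
    exit point \<open>s n - (l n / 2) *\<^sub>R c n\<close>. A midpoint of two such points loses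
    only 3/4 of each of the two terms, so all weights stay nonnegative and it remains in
    \<open>C\<close>.\<close>
  define a where "a n = u - (3/2 * l n) *\<^sub>R c n" for n
  have out: "a n \<notin> C" for n
  proof (rule away)
    have "a n - (s n - (l n / 2) *\<^sub>R c n) = u - s (Suc n)"
      by (simp add: a_def s_def algebra_simps flip: scaleR_left_distrib)
    then show "N (a n - (s n - (l n / 2) *\<^sub>R c n)) \<le> r n" using u_tail[of n] by simp
  qed
  have mid: "(1/2) *\<^sub>R a i + (1/2) *\<^sub>R a j \<in> C" if "i \<noteq> j" for i j
  proof -
    define b where "b = (3/4 * l i) *\<^sub>R c i + (3/4 * l j) *\<^sub>R c j"
    have "s m - b \<in> C" if "max i j < m" for m
    proof -
      define \<mu> where "\<mu> k = l k - (if k = i then 3/4 * l i else 0) - (if k = j then 3/4 * l j else 0)" for k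
      have \<mu>: "0 \<le> \<mu> k" "\<mu> k \<le> l k" for k
        using l_pos[of k] \<open>i \<noteq> j\<close> by (auto simp: \<mu>_def less_imp_le)
      have "(\<Sum>k<m. \<mu> k) \<le> (\<Sum>k<m. (1/2) ^ (k + 2))"
        using \<mu>(2) l_le by (intro sum_mono) (meson order_trans)
      then have "(\<Sum>k<m. \<mu> k) \<le> 1" using geo[of m] by simp
      then have "(\<Sum>k<m. \<mu> k *\<^sub>R c k) \<in> C"
        using \<mu>(1) c_in by (intro convex_subsum_mem[OF \<open>convex C\<close> \<open>0 \<in> C\<close>]) auto
      also have "(\<Sum>k<m. \<mu> k *\<^sub>R c k) = s m - b"
      proof -
        have "\<mu> k *\<^sub>R c k = l k *\<^sub>R c k - (if k = i then (3/4 * l i) *\<^sub>R c i else 0)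
            - (if k = j then (3/4 * l j) *\<^sub>R c j else 0)" for k
          using \<open>i \<noteq> j\<close> by (auto simp: \<mu>_def scaleR_left_diff_distrib)
        then show ?thesis using that by (simp add: sum_subtractf s_def b_def)
      qed
      finally show ?thesis .
    qed
    then have "\<forall>\<^sub>F m in sequentially. s m - b \<in> C"
      by (intro eventually_mono[OF eventually_gt_at_top[of "max i j"]])
    moreover have "(\<lambda>m. s m - b) \<longlonglongrightarrow> u - b" by (intro tendsto_intros u)
    ultimately have "u - b \<in> C"
      by (intro Lim_in_closed_set[OF \<open>closed C\<close>, of _ sequentially]) auto
    moreover have "(1/2) *\<^sub>R a i + (1/2) *\<^sub>R a j = ((1/2) *\<^sub>R u + (1/2) *\<^sub>R u) - b"
      unfolding a_def b_def by (simp add: algebra_simps)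
    ultimately show ?thesis by (simp flip: scaleR_left_distrib)
  qed
  have "inj a"
  proof (rule injI, rule ccontr)
    fix i j assume "a i = a j" "i \<noteq> j"
    then show False using mid[of i j] out[of j] by (simp flip: scaleR_left_distrib)
  qed
  then have "infinite (range a)" by (simp add: finite_image_iff)
  moreover have "hides C (range a)"
    unfolding hides_def
  proof (intro conjI ballI impI subsetI)
    fix x y assume "x \<in> range a" "y \<in> range a" "x \<noteq> y"
    then obtain i j where ij: "x = a i" "y = a j" "i \<noteq> j" by blast
    have "(1/2) *\<^sub>R a i + (1/2) *\<^sub>R a j \<in> closed_segment (a i) (a j)"
      by (auto simp: in_segment intro!: exI[of _ "1/2"])
    then show "closed_segment x y \<inter> C \<noteq> {}" using mid[OF ij(3)] ij by blast
  qed (use out in auto)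
  ultimately show ?thesis by blast
qed

section \<open>Polyhedrality\<close>

text \<open>Half-spaces and their complements remain convex when cut down to the affine hull, which
  lies between \<open>C\<close> and its closed linear hull.\<close>

lemma polyhedral_imp_polyhedric:
  fixes C :: "'a::linear_topological_space set"
  assumes "polyhedral_in C (closure (span C))"
  shows "polyhedric_in C (affine hull C)"
proof -
  obtain n :: nat and f a where "convex C"
    and f: "\<And>i. i < n \<Longrightarrow> continuous_linear_functional_on (closure (span C)) (f i)"
    and C: "C = {x \<in> closure (span C). \<forall>i<n. f i x \<le> a i}"
    using assms unfolding polyhedral_in_def by blast
  define D where "D = affine hull C"
  have D_span: "D \<subseteq> span C" unfolding D_def by (rule affine_hull_subset_span)
  have "convex D" unfolding D_def by (rule affine_imp_convex) simp
  define H where "H i = {x \<in> D. f i x \<le> a i}" for i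
  \<comment> \<open>\<open>f i\<close> is linear only on the closed span, so the points and their
    multiples have to be located there first.\<close>
  have comb: "f i (u *\<^sub>R x + v *\<^sub>R y) = u * f i x + v * f i y"
    if "i < n" "x \<in> D" "y \<in> D" for i u v x y
  proof -
    have "x \<in> span C" "y \<in> span C" using that D_span by auto
    then have "x \<in> closure (span C)" "y \<in> closure (span C)"
      "u *\<^sub>R x \<in> closure (span C)" "v *\<^sub>R y \<in> closure (span C)"
      using closure_subset span_mul by blast+
    then show ?thesis using f[OF that(1)] by (simp add: continuous_linear_functional_on_def)
  qed
  have "convex (H i)" if "i < n" for i
  proof (rule convexI)
    fix x y u v assume xy: "x \<in> H i" "y \<in> H i" and uv: "0 \<le> u" "0 \<le> v" "u + v = (1::real)"
    then have D: "x \<in> D" "y \<in> D" by (auto simp: H_def)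
    have "u * f i x + v * f i y \<le> u * a i + v * a i"
      using xy uv by (intro add_mono mult_left_mono) (auto simp: H_def)
    also have "\<dots> = a i" using uv by (simp flip: distrib_right)
    finally show "u *\<^sub>R x + v *\<^sub>R y \<in> H i"
      using comb[OF that D] convexD[OF \<open>convex D\<close> D uv] by (simp add: H_def)
  qed
  moreover have "convex (D - H i)" if "i < n" for i
  proof (rule convexI)
    fix x y u v assume xy: "x \<in> D - H i" "y \<in> D - H i" and uv: "0 \<le> u" "0 \<le> v" "u + v = (1::real)"
    then have D: "x \<in> D" "y \<in> D" and gt: "a i < f i x" "a i < f i y" by (auto simp: H_def)
    have "u * (f i x - a i) + v * (f i y - a i) > 0"
    proof (cases "u = 0")
      case False
      then have "0 < u * (f i x - a i)" using gt uv by simp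
      moreover have "0 \<le> v * (f i y - a i)" using gt uv by simp
      ultimately show ?thesis by simp
    qed (use gt uv in simp)
    moreover have "u * a i + v * a i = a i" using uv by (simp flip: distrib_right)
    ultimately have "a i < u * f i x + v * f i y" by (simp add: right_diff_distrib)
    then show "u *\<^sub>R x + v *\<^sub>R y \<in> D - H i"
      using comb[OF that D] convexD[OF \<open>convex D\<close> D uv] by (simp add: H_def)
  qed
  moreover have C_eq: "C = D \<inter> \<Inter>(H ` {..<n})"
  proof
    show "C \<subseteq> D \<inter> \<Inter>(H ` {..<n})"
      using C hull_subset[of C affine] unfolding D_def H_def by blast
    have "D \<subseteq> closure (span C)" using D_span closure_subset by blast
    then show "D \<inter> \<Inter>(H ` {..<n}) \<subseteq> C"
      by (subst C) (auto simp: H_def)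
  qed
  ultimately have "\<forall>H\<in>H ` {..<n}. H \<subseteq> D \<and> convex H \<and> convex (D - H)"
    by (auto simp: H_def)
  then have "\<exists>\<H>. finite \<H> \<and> (\<forall>H\<in>\<H>. H \<subseteq> D \<and> convex H \<and> convex (D - H)) \<and> C = D \<inter> \<Inter>\<H>"
    using C_eq by (intro exI[of _ "H ` {..<n}"] conjI) simp_all
  moreover have "C \<subseteq> D" unfolding D_def by (rule hull_subset)
  ultimately show ?thesis
    unfolding polyhedric_in_def D_def[symmetric] using \<open>convex C\<close> \<open>convex D\<close> by blast
qed

section \<open>Sets hidden behind polyhedric sets\<close>

text \<open>From the three points of \<open>D\<close> on the sides of the triangle, a combination
  can be formed in which \<open>b\<close> and \<open>c\<close> cancel. It is a positive multiple of
  \<open>a\<close>, and after normalisation an affine combination, which puts \<open>a\<close> into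
  \<open>D\<close>.\<close>

lemma affine_no_three_hidden:
  fixes D :: "'a::real_vector set"
  assumes "affine D" and out: "a \<notin> D" "b \<notin> D" "c \<notin> D"
    and meet: "closed_segment a b \<inter> D \<noteq> {}" "closed_segment a c \<inter> D \<noteq> {}" "closed_segment b c \<inter> D \<noteq> {}"
  shows False
proof -
  have inner: "\<exists>t q. 0 < t \<and> t < 1 \<and> q \<in> D \<and> q = (1 - t) *\<^sub>R x + t *\<^sub>R y"
    if xy: "closed_segment x y \<inter> D \<noteq> {}" "x \<notin> D" "y \<notin> D" for x y
  proof -
    obtain t where t: "0 \<le> t" "t \<le> 1" "(1 - t) *\<^sub>R x + t *\<^sub>R y \<in> D"
      using xy(1) by (auto simp: in_segment)
    moreover have "t \<noteq> 0" "t \<noteq> 1" using t(3) xy(2,3) by auto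
    ultimately show ?thesis by (intro exI[of _ t]) auto
  qed
  obtain u q1 where u: "0 < u" "u < 1" "q1 \<in> D" "q1 = (1 - u) *\<^sub>R a + u *\<^sub>R b"
    using inner[OF meet(1) out(1,2)] by blast
  obtain v q2 where v: "0 < v" "v < 1" "q2 \<in> D" "q2 = (1 - v) *\<^sub>R a + v *\<^sub>R c"
    using inner[OF meet(2) out(1,3)] by blast
  obtain w q3 where w: "0 < w" "w < 1" "q3 \<in> D" "q3 = (1 - w) *\<^sub>R b + w *\<^sub>R c"
    using inner[OF meet(3) out(2,3)] by blast
  \<comment> \<open>\<open>\<alpha>\<close> and \<open>\<beta>\<close> are the coefficients for
    which \<open>b\<close> and \<open>c\<close> cancel in
    \<open>\<alpha> *\<^sub>R q1 + \<beta> *\<^sub>R q2 - q3\<close>.\<close>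
  define \<alpha> where "\<alpha> = (1 - w) / u"
  define \<beta> where "\<beta> = w / v"
  define k where "k = \<alpha> * (1 - u) + \<beta> * (1 - v)"
  have pos: "0 < \<alpha>" "0 < \<beta>" using u v w by (auto simp: \<alpha>_def \<beta>_def)
  then have "0 < k" using u v by (simp add: k_def add_pos_pos)
  have au: "\<alpha> * u = 1 - w" "\<beta> * v = w" using u v by (auto simp: \<alpha>_def \<beta>_def)
  have "\<alpha> *\<^sub>R q1 + \<beta> *\<^sub>R q2 - q3 = k *\<^sub>R a + (\<alpha> * u - (1 - w)) *\<^sub>R b + (\<beta> * v - w) *\<^sub>R c"
    unfolding u(4) v(4) w(4) k_def by (simp add: algebra_simps)
  then have eq: "\<alpha> *\<^sub>R q1 + \<beta> *\<^sub>R q2 + (-1) *\<^sub>R q3 = k *\<^sub>R a" by (simp add: au)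
  then have "a = (\<alpha> / k) *\<^sub>R q1 + (\<beta> / k) *\<^sub>R q2 + (- 1 / k) *\<^sub>R q3"
  proof -
    have "a = (1 / k) *\<^sub>R (k *\<^sub>R a)" using \<open>0 < k\<close> by simp
    also have "\<dots> = (1 / k) *\<^sub>R (\<alpha> *\<^sub>R q1 + \<beta> *\<^sub>R q2 + (-1) *\<^sub>R q3)" by (simp only: eq)
    also have "\<dots> = (\<alpha> / k) *\<^sub>R q1 + (\<beta> / k) *\<^sub>R q2 + (- 1 / k) *\<^sub>R q3"
      by (simp add: scaleR_right_distrib scaleR_right_diff_distrib)
    finally show ?thesis .
  qed
  moreover have "\<alpha> / k + \<beta> / k + (- 1 / k) = 1"
  proof -
    have "k = \<alpha> + \<beta> - 1" using au by (simp add: k_def right_diff_distrib)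
    moreover have "\<alpha> / k + \<beta> / k + (- 1 / k) = (\<alpha> + \<beta> - 1) / k"
      by (simp add: add_divide_distrib diff_divide_distrib)
    ultimately show ?thesis using \<open>0 < k\<close> by simp
  qed
  moreover have "\<alpha>' *\<^sub>R q1 + \<beta>' *\<^sub>R q2 + \<gamma>' *\<^sub>R q3 \<in> D" if "\<alpha>' + \<beta>' + \<gamma>' = 1" for \<alpha>' \<beta>' \<gamma>'
    using mem_affine_3[OF \<open>affine D\<close> u(3) v(3) w(3) that] .
  ultimately show False using out(1) by metis
qed

text \<open>If \<open>A\<close> meets the affine hull it lies inside it, and the pigeonhole
  principle yields two points in the same convex complement \<open>D - H\<close>. If
  \<open>A\<close> misses the hull, it cannot even have three points.\<close>

lemma polyhedric_imp_no_hidden: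
  fixes C :: "'a::real_vector set"
  assumes "polyhedric_in C (affine hull C)" and hid: "hides C A"
  shows "finite A"
proof (rule ccontr)
  assume "infinite A"
  define D where "D = affine hull C"
  have "affine D" "C \<subseteq> D" by (auto simp: D_def hull_inc)
  obtain \<H> where \<H>: "finite \<H>" "\<And>H. H \<in> \<H> \<Longrightarrow> convex (D - H)" "C = D \<inter> \<Inter>\<H>"
    using assms(1) unfolding polyhedric_in_def D_def by blast
  have out: "a \<notin> C" if "a \<in> A" for a by (rule hidesD(1)[OF hid that])
  have meet: "closed_segment a b \<inter> C \<noteq> {}" if "a \<in> A" "b \<in> A" "a \<noteq> b" for a b
    by (rule hidesD(2)[OF hid that])
  have "A \<inter> D = {}"
  proof (rule ccontr)
    assume "A \<inter> D \<noteq> {}"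
    then obtain a where a: "a \<in> A" "a \<in> D" by blast
    \<comment> \<open>\<open>b\<close> lies on the line through \<open>a\<close> and a point of
      \<open>C\<close>, and this line is contained in \<open>D\<close>.\<close>
    have "A \<subseteq> D"
    proof
      fix b assume "b \<in> A"
      show "b \<in> D"
      proof (cases "a = b")
        case False
        then obtain t where t: "(1 - t) *\<^sub>R a + t *\<^sub>R b \<in> C"
          using meet[OF a(1) \<open>b \<in> A\<close>] by (auto simp: in_segment)
        then have "t \<noteq> 0" using out[OF a(1)] by auto
        have "(1 / t) *\<^sub>R ((1 - t) *\<^sub>R a + t *\<^sub>R b) + (1 - 1 / t) *\<^sub>R a \<in> D"
          by (rule mem_affine[OF \<open>affine D\<close> subsetD[OF \<open>C \<subseteq> D\<close> t] a(2)]) simp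
        also have "(1 / t) *\<^sub>R ((1 - t) *\<^sub>R a + t *\<^sub>R b) + (1 - 1 / t) *\<^sub>R a =
            ((1 / t) * (1 - t) + (1 - 1 / t)) *\<^sub>R a + b"
          using \<open>t \<noteq> 0\<close> by (simp add: scaleR_right_distrib scaleR_left_distrib)
        also have "\<dots> = b" using \<open>t \<noteq> 0\<close> by (simp add: field_simps)
        finally show ?thesis .
      qed (use a in simp)
    qed
    \<comment> \<open>Each point of \<open>A\<close> is assigned a member of \<open>\<H>\<close>
      that misses it; infinitely many points share finitely many members.\<close>
    then have "\<exists>H. H \<in> \<H> \<and> a \<in> D - H" if "a \<in> A" for a
      using out[OF that] \<H>(3) that by blast
    then obtain h where h: "\<And>a. a \<in> A \<Longrightarrow> h a \<in> \<H> \<and> a \<in> D - h a" by metis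
    then have "h ` A \<subseteq> \<H>" by blast
    then have "\<not> inj_on h A"
      using \<open>infinite A\<close> \<open>finite \<H>\<close> by (meson finite_imageD finite_subset)
    then obtain a b where ab: "a \<in> A" "b \<in> A" "a \<noteq> b" "h a = h b" by (auto simp: inj_on_def)
    then have "closed_segment a b \<subseteq> D - h a"
      using h[of a] h[of b] \<H>(2)[of "h a"] by (intro closed_segment_subset) auto
    moreover have "C \<inter> (D - h a) = {}" using \<H>(3) h[OF ab(1)] by blast
    ultimately show False using meet[OF ab(1-3)] by blast
  qed
  obtain B where B: "B \<subseteq> A" "finite B" "card B = 3"
    using infinite_arbitrarily_large[OF \<open>infinite A\<close>] by blast
  then obtain a b c where abc: "a \<in> A" "b \<in> A" "c \<in> A" "a \<noteq> b" "a \<noteq> c" "b \<noteq> c"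
    by (auto simp: card_3_iff)
  then show False
    using affine_no_three_hidden[OF \<open>affine D\<close>, of a b c] meet[of a b] meet[of a c] meet[of b c]
      \<open>A \<inter> D = {}\<close> \<open>C \<subseteq> D\<close> by blast
qed

section \<open>Recentring at an internal point and closedness of the span\<close>

lemma hides_translation:
  assumes "hides ((+) a ` C) A"
  shows "hides C ((+) (- a) ` A)"
proof -
  have mem: "y \<in> (+) a ` C \<longleftrightarrow> - a + y \<in> C" for y
    by (force simp: image_iff)
  have "closed_segment (- a + x) (- a + y) \<inter> C \<noteq> {}" if xy: "x \<in> A" "y \<in> A" "x \<noteq> y" for x y
  proof -
    obtain z where "z \<in> closed_segment x y" "z \<in> (+) a ` C" using hidesD(2)[OF assms xy] by blast
    then have "- a + z \<in> closed_segment (- a + x) (- a + y)" "- a + z \<in> C"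
      using mem by (auto simp only: closed_segment_translation)
    then show ?thesis by blast
  qed
  then show ?thesis
    unfolding hides_def using hidesD(1)[OF assms] mem by auto
qed

lemma closed_translation_lts:
  fixes C :: "'a::linear_topological_space set"
  assumes "closed C"
  shows "closed ((+) a ` C)"
proof -
  have "(+) a ` C = (\<lambda>x. x - a) -` C" by (force simp: image_iff)
  moreover have "closed ((\<lambda>x. x - a) -` C)"
    by (intro closed_vimage assms continuous_intros)
  ultimately show ?thesis by simp
qed

text \<open>\<open>no_internal_point_hides\<close> expects 0 in the set, so an arbitrary point of
  \<open>C\<close> is moved to 0 first; the internal point \<open>s\<close> found then becomes the
  new origin.\<close>

lemma no_hidden_internal_point:
  fixes C :: "'a::linear_topological_space set"
  assumes "complete_linear_metric_space TYPE('a)" "closed C" "convex C" "C \<noteq> {}"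
    and no_hidden: "\<not> (\<exists>A. infinite A \<and> hides C A)"
  obtains c where "c \<in> C"
    "\<And>v. v \<in> span ((+) (- c) ` C) \<Longrightarrow> \<exists>t>0. t *\<^sub>R v \<in> (+) (- c) ` C"
proof -
  obtain c0 where "c0 \<in> C" using \<open>C \<noteq> {}\<close> by blast
  define C0 where "C0 = (+) (- c0) ` C"
  have C0: "y \<in> C0 \<longleftrightarrow> c0 + y \<in> C" for y by (force simp: C0_def image_iff)
  have "\<not> (\<exists>A. infinite A \<and> hides C0 A)"
  proof
    assume "\<exists>A. infinite A \<and> hides C0 A"
    then obtain A where A: "infinite A" "hides C ((+) (- (- c0)) ` A)"
      using hides_translation unfolding C0_def by blast
    then have "infinite ((+) (- (- c0)) ` A)" by (simp only: finite_image_iff inj_on_add not_False_eq_True)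
    then show False using no_hidden A(2) by blast
  qed
  moreover have "closed C0" "convex C0"
    unfolding C0_def by (intro closed_translation_lts convex_translation assms)+
  moreover have "0 \<in> C0" using \<open>c0 \<in> C\<close> by (simp add: C0)
  ultimately obtain s where s: "s \<in> C0" "\<And>v. v \<in> span C0 \<Longrightarrow> \<exists>t>0. s + t *\<^sub>R v \<in> C0"
    using no_internal_point_hides[OF assms(1), of C0] by blast
  define c where "c = c0 + s"
  have C1: "y \<in> (+) (- c) ` C \<longleftrightarrow> s + y \<in> C0" for y
    by (force simp: C0 c_def image_iff algebra_simps)
  have "(+) (- c) ` C \<subseteq> span C0"
  proof
    fix y assume "y \<in> (+) (- c) ` C"
    then have "s + y \<in> C0" by (simp only: C1)
    then have "(s + y) - s \<in> span C0" using s(1) by (intro span_diff span_base)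
    then show "y \<in> span C0" by simp
  qed
  then have "span ((+) (- c) ` C) \<subseteq> span C0" by (intro span_minimal) auto
  moreover have "c \<in> C" using s(1) C0 by (simp add: c_def)
  ultimately show thesis using that[of c] s(2) C1 by blast
qed

lemma polyhedral_inI:
  assumes "convex C" "C \<subseteq> L" "finite P"
    and "\<And>f a. (f, a) \<in> P \<Longrightarrow> continuous_linear_functional_on L f"
    and eq: "\<And>x. x \<in> L \<Longrightarrow> x \<in> C \<longleftrightarrow> (\<forall>(f, a)\<in>P. f x \<le> a)"
  shows "polyhedral_in C L"
proof -
  obtain xs where xs: "set xs = P" using finite_list[OF \<open>finite P\<close>] by blast
  have "\<forall>i<length xs. continuous_linear_functional_on L (fst (xs ! i))"
    using assms(4) xs by (metis nth_mem prod.collapse)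
  moreover have "x \<in> C \<longleftrightarrow> x \<in> L \<and> (\<forall>i<length xs. fst (xs ! i) x \<le> snd (xs ! i))" for x
    using eq[of x] \<open>C \<subseteq> L\<close> unfolding xs[symmetric] all_set_conv_all_nth
    by (auto simp: case_prod_beta)
  then have "C = {x \<in> L. \<forall>i<length xs. fst (xs ! i) x \<le> snd (xs ! i)}" by blast
  ultimately show ?thesis
    unfolding polyhedral_in_def using assms(1,2)
    by (intro conjI exI[of _ "length xs"] exI[of _ "\<lambda>i. fst (xs ! i)"] exI[of _ "\<lambda>i. snd (xs ! i)"])
qed

lemma continuous_linear_functional_onI:
  "linear f \<Longrightarrow> continuous_on L f \<Longrightarrow> continuous_linear_functional_on L f"
  by (simp add: continuous_linear_functional_on_def linear_add linear_scale)

text \<open>The recentred set \<open>C1\<close> is cut out of its span \<open>Y\<close> by the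
  functionals in \<open>F\<close>. Closedness passes from \<open>C1\<close> to their common kernel,
  then to \<open>Y\<close> and \<open>span C\<close>. One more functional \<open>\<phi>\<close>
  describes the translate \<open>c + Y\<close> inside \<open>span C\<close>.\<close>

lemma no_hidden_imp_polyhedral:
  fixes C :: "'a::linear_topological_space set"
  assumes "complete_linear_metric_space TYPE('a)" "closed C" "convex C"
    and no_hidden: "\<not> (\<exists>A. infinite A \<and> hides C A)"
  shows "polyhedral_in C (closure (span C))"
proof (cases "C = {}")
  case True
  have "linear (\<lambda>_ :: 'a. 0 :: real)" by (rule linear_zero)
  then have "continuous_linear_functional_on (closure (span C)) (\<lambda>_ :: 'a. 0)"
    by (rule continuous_linear_functional_onI) simp
  \<comment> \<open>The unsatisfiable constraint \<open>0 \<le> - 1\<close> describes the empty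
    set.\<close>
  then show ?thesis
    using True by (intro polyhedral_inI[of _ _ "{(\<lambda>_. 0, - 1)}"]) auto
next
  case False
  obtain c where c: "c \<in> C"
    and absorbing: "\<And>v. v \<in> span ((+) (- c) ` C) \<Longrightarrow> \<exists>t>0. t *\<^sub>R v \<in> (+) (- c) ` C"
    using no_hidden_internal_point[OF assms(1-3) False no_hidden] by metis
  define C1 where "C1 = (+) (- c) ` C"
  define Y where "Y = span C1"
  have C1: "y \<in> C1 \<longleftrightarrow> c + y \<in> C" for y by (force simp: C1_def image_iff)
  have "subspace Y" "C1 \<subseteq> Y" by (auto simp: Y_def span_base)
  have "closed C1" "convex C1"
    unfolding C1_def by (intro closed_translation_lts convex_translation assms)+
  have radial: "x \<in> C1" if x: "\<And>t. 0 \<le> t \<Longrightarrow> t < 1 \<Longrightarrow> t *\<^sub>R x \<in> C1" for x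
  proof -
    have "((\<lambda>t. t *\<^sub>R x) \<longlongrightarrow> 1 *\<^sub>R x) (at_left 1)"
      by (intro tendsto_scaleR_lts tendsto_const) (simp add: tendsto_ident_at)
    moreover have "\<forall>\<^sub>F t in at_left (1::real). t \<in> {0<..<1}"
      by (rule eventually_at_left_real) simp
    then have "\<forall>\<^sub>F t in at_left 1. t *\<^sub>R x \<in> C1" by eventually_elim (simp add: x)
    ultimately show ?thesis
      using Lim_in_closed_set[OF \<open>closed C1\<close>, of "\<lambda>t. t *\<^sub>R x" "at_left 1"] by simp
  qed
  have absorbing1: "\<exists>t>0. t *\<^sub>R v \<in> C1" if "v \<in> Y" for v
    using absorbing that unfolding C1_def Y_def by blast
  have no_hidden1: "\<not> (\<exists>A. infinite A \<and> hides C1 A)"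
  proof
    assume "\<exists>A. infinite A \<and> hides C1 A"
    then obtain A where A: "infinite A" "hides C ((+) (- (- c)) ` A)"
      using hides_translation unfolding C1_def by blast
    then have "infinite ((+) (- (- c)) ` A)" by (simp only: finite_image_iff inj_on_add not_False_eq_True)
    then show False using no_hidden A(2) by blast
  qed
  obtain F where F: "finite F" "\<And>f. f \<in> F \<Longrightarrow> linear f"
    and C1_eq: "C1 = {x \<in> Y. \<forall>f\<in>F. f x \<le> (1::real)}"
    by (rule relatively_absorbing_polyhedral
        [OF \<open>subspace Y\<close> \<open>C1 \<subseteq> Y\<close> \<open>convex C1\<close> absorbing1 radial no_hidden1]) (assumption | rule that | blast)+
  define M where "M = {x \<in> Y. \<forall>f\<in>F. f x = 0}"
  have "closed M"
  proof -
    \<comment> \<open>All multiples of elements of \<open>M\<close> lie in the closed set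
      \<open>C1\<close>, hence so do all multiples of \<open>x\<close>; a linear functional bounded
      above on a line through 0 vanishes there.\<close>
    have "x \<in> M" if x: "x \<in> closure M" for x
    proof -
      have "t *\<^sub>R x \<in> C1" for t
      proof -
        have "continuous_on (closure M) (\<lambda>y. t *\<^sub>R y)"
          by (intro continuous_on_scaleR_lts continuous_intros)
        moreover have "t *\<^sub>R y \<in> C1" if "y \<in> M" for y
          using that F(2) subspace_scale[OF \<open>subspace Y\<close>] by (auto simp: M_def C1_eq linear_scale)
        ultimately have "(\<lambda>y. t *\<^sub>R y) ` closure M \<subseteq> C1"
          using image_closure_subset[OF _ \<open>closed C1\<close>] by blast
        then show ?thesis using x by blast
      qed
      then have tx: "t *\<^sub>R x \<in> Y" "\<forall>f\<in>F. f (t *\<^sub>R x) \<le> 1" for t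
        unfolding C1_eq by simp_all
      have Y: "x \<in> Y" using tx(1)[of 1] by simp
      have le: "t * f x \<le> 1" if "f \<in> F" for f t
        using tx(2)[of t] that linear_scale[OF F(2)[OF that], of t x] by force
      have "f x = 0" if "f \<in> F" for f
      proof (rule ccontr)
        assume "f x \<noteq> 0"
        then show False using le[OF that, of "2 / f x"] by simp
      qed
      then show ?thesis using Y by (simp add: M_def)
    qed
    then have "closure M = M" using closure_subset by blast
    then show ?thesis by (simp add: closure_eq)
  qed
  then have "closed Y"
    and ext_Y: "\<And>g :: 'a \<Rightarrow> real. linear g \<Longrightarrow> continuous_on M g \<Longrightarrow> continuous_on Y g"
    using closed_of_closed_kernel[OF F \<open>subspace Y\<close>] by (auto simp: M_def)
  define L where "L = span (insert c Y)"
  have "closed L" and ext_L: "\<And>g :: 'a \<Rightarrow> real. linear g \<Longrightarrow> continuous_on Y g \<Longrightarrow> continuous_on L g"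
    unfolding L_def by (rule closed_span_insert[OF \<open>closed Y\<close> \<open>subspace Y\<close>]; assumption)+
  have "span C = L"
  proof
    have "x \<in> L" if "x \<in> C" for x
    proof -
      have "x - c \<in> Y" using \<open>C1 \<subseteq> Y\<close> that C1[of "x - c"] by auto
      then have "(x - c) + c \<in> L" unfolding L_def by (intro span_add span_base) auto
      then show ?thesis by simp
    qed
    then show "span C \<subseteq> L" unfolding L_def by (intro span_minimal) auto
    have "y \<in> span C" if "y \<in> C1" for y
    proof -
      have "(c + y) - c \<in> span C" using that c by (intro span_diff span_base) (simp_all add: C1)
      then show ?thesis by simp
    qed
    then have "Y \<subseteq> span C" unfolding Y_def by (intro span_minimal) auto
    then show "L \<subseteq> span C" unfolding L_def using c by (intro span_minimal) (auto simp: span_base)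
  qed
  then have cl: "closure (span C) = L" using \<open>closed L\<close> by simp
  \<comment> \<open>\<open>c + Y\<close> is the level set of \<open>\<phi>\<close> through
    \<open>c\<close> in \<open>L\<close>. If \<open>c\<close> lies in \<open>Y\<close>, then
    \<open>L = Y\<close> and the zero functional does this.\<close>
  obtain \<phi> :: "'a \<Rightarrow> real" where \<phi>: "linear \<phi>" "\<And>y. y \<in> Y \<Longrightarrow> \<phi> y = 0"
    and \<phi>_c: "\<And>x. x \<in> L \<Longrightarrow> \<phi> x = \<phi> c \<Longrightarrow> x - c \<in> Y"
  proof (cases "c \<in> Y")
    case True
    then have "L = Y" using \<open>subspace Y\<close> by (simp add: L_def insert_absorb)
    then show thesis
      using that[of "\<lambda>_. 0"] linear_zero True subspace_diff[OF \<open>subspace Y\<close>] by auto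
  next
    case False
    obtain \<phi> :: "'a \<Rightarrow> real" where \<phi>: "linear \<phi>" "\<And>y. y \<in> Y \<Longrightarrow> \<phi> y = 0" "\<phi> c = 1"
      using separating_linear_functional[OF \<open>subspace Y\<close> False] by blast
    have "x - c \<in> Y" if "x \<in> L" "\<phi> x = \<phi> c" for x
      using mem_span_insert_iff[OF \<open>subspace Y\<close> \<phi>, of x] that \<phi>(3) by (simp add: L_def)
    then show thesis using that \<phi> by blast
  qed
  \<comment> \<open>The functionals in \<open>F\<close> vanish on \<open>M\<close> and
    \<open>\<phi>\<close> vanishes on \<open>Y\<close>, so each is continuous on the subspace from
    which continuity is extended to \<open>L\<close>.\<close>
  have cont_zero: "continuous_on S g" if "\<And>x. x \<in> S \<Longrightarrow> g x = 0" for S and g :: "'a \<Rightarrow> real"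
    using continuous_on_cong[of S S g "\<lambda>_. 0"] that by simp
  have cont_F: "continuous_on L f" if "f \<in> F" for f
    using that F(2) by (intro ext_L ext_Y cont_zero) (auto simp: M_def)
  have cont_\<phi>: "continuous_on L \<phi>" using \<phi> by (intro ext_L cont_zero) auto
  \<comment> \<open>Two inequalities encode \<open>\<phi> x = \<phi> c\<close>; the bounds
    \<open>1 + f c\<close> undo the recentring.\<close>
  define P where "P = insert (\<phi>, \<phi> c) (insert (\<lambda>x. - \<phi> x, - \<phi> c) ((\<lambda>f. (f, 1 + f c)) ` F))"
  show ?thesis
    unfolding cl
  proof (rule polyhedral_inI[of _ _ P])
    show "C \<subseteq> L" using \<open>span C = L\<close> span_superset by blast
    show "finite P" using F(1) by (simp add: P_def)
    show "continuous_linear_functional_on L f" if "(f, a) \<in> P" for f a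
      using that F(2) cont_F \<phi>(1) cont_\<phi> unfolding P_def
      by (auto intro!: continuous_linear_functional_onI continuous_intros linear_compose_neg)
    show "x \<in> C \<longleftrightarrow> (\<forall>(f, a)\<in>P. f x \<le> a)" if "x \<in> L" for x
    proof -
      have "x \<in> C \<longleftrightarrow> x - c \<in> Y \<and> (\<forall>f\<in>F. f (x - c) \<le> 1)"
        using C1[of "x - c"] C1_eq by auto
      also have "\<dots> \<longleftrightarrow> \<phi> x = \<phi> c \<and> (\<forall>f\<in>F. f x \<le> 1 + f c)"
      proof -
        have "\<phi> x = \<phi> c" if "x - c \<in> Y"
          using \<phi>(2)[OF that] by (simp add: linear_diff[OF \<phi>(1)])
        then have "x - c \<in> Y \<longleftrightarrow> \<phi> x = \<phi> c" using \<phi>_c[OF \<open>x \<in> L\<close>] by blast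
        moreover have "f (x - c) \<le> 1 \<longleftrightarrow> f x \<le> 1 + f c" if "f \<in> F" for f
          by (simp add: linear_diff[OF F(2)[OF that]] algebra_simps)
        ultimately show ?thesis by auto
      qed
      also have "\<dots> \<longleftrightarrow> (\<forall>(f, a)\<in>P. f x \<le> a)" by (auto simp: P_def)
      finally show ?thesis .
    qed
  qed (rule \<open>convex C\<close>)
qed

theorem theorem1p1:
  fixes C :: "'a::linear_topological_space set"
  assumes "complete_linear_metric_space TYPE('a)"
    and "closed C"
    and "convex C"
  shows "(polyhedral_in C (closure (span C)) \<longleftrightarrow> polyhedric_in C (affine hull C)) \<and>
         (polyhedric_in C (affine hull C) \<longleftrightarrow>
            \<not> (\<exists>A. A \<subseteq> UNIV - C \<and> infinite A \<and> hides C A))"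
proof -
  have "polyhedral_in C (closure (span C))"
    if "\<not> (\<exists>A. A \<subseteq> UNIV - C \<and> infinite A \<and> hides C A)"
    using no_hidden_imp_polyhedral[OF assms] that by (auto simp: hides_def)
  then show ?thesis
    using polyhedral_imp_polyhedric[of C] polyhedric_imp_no_hidden[of C] by blast
qed

end
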